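(* Fix $d\ge 2$ and $n\ge 1$, and let $s$ be a positive integer (so $s=O(n^d)$) satisfying $$ s \le \frac12\left(\binom{n+d}{d}+1\right) - \binom{n+d}{d}^{-1}\binom{n+2d}{2d}. $$ For generically chosen $\{(w_i,z_i)\}_{i=1}^s\in(\mathbb{R}\times\mathbb{R}^n)^{\times s}$ the following holds. Let $X=\sum_{i=1}^s w_i^2\,m_d(z_i)m_d(z_i)^{\mathsf T}$ and $\mathcal{C}=\mathcal{M}^{\mathsf{ps}}_{n+1,2d}$. If the problems defining $M_k$ and $t_k$ are solved in exact arithmetic at every iteration, then the extreme ray decomposition algorithm (described in the context) run on $(\mathcal{C},X)$ almost surely returns $\{t_k,M_k\}_{k=1}^r$ with $r=s$ and, up to a reordering of the indices of $\{(w_i,z_i)\}_{i=1}^s$, $$ t_k=w_k^2\,\|m_d(z_k)\|_2^2,\qquad M_k=\frac{1}{\|m_d(z_k)\|_2^2}\,m_d(z_k)m_d(z_k)^{\mathsf T},\qquad k=1,\dots,s. $$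
   Context: Multi-indices: $\mathbb{N}^{n}_{\le d}=\{\alpha\in\mathbb{N}^n: |\alpha|\le d\}$ and $\mathbb{N}^{n}_{d}=\{\alpha\in\mathbb{N}^n:|\alpha|=d\}$, ordered by the graded lexicographic order. For $z\in\mathbb{R}^n$, $m_d(z)=(z^\alpha)_{\alpha\in\mathbb{N}^n_{\le d}}\in\mathbb{R}^{\binom{n+d}{d}}$ is the vector of all monomials of degree at most $d$ (first entry $1$). With $\tilde z=[1;z]\in\mathbb{R}^{n+1}$, $m_d(z)=v_d(\tilde z)$, where $v_d(u)=(u^\alpha)_{\alpha\in\mathbb{N}^{n+1}_d}$; i.e. index sets are identified by $\alpha\leftrightarrow(d-|\alpha|,\alpha)$. $\mathbb{S}^N$ is the space of real symmetric $N\times N$ matrices, $\mathbb{S}^N_+$ the positive semidefinite cone, $\langle A,B\rangle=\mathrm{tr}(AB)$. With $N=\binom{n+d}{d}$ and rows/columns indexed by $\mathbb{N}^{n+1}_d$, let $$\mathcal{H}_{n+1,d}=\{X\in\mathbb{S}^N : X_{\alpha,\beta}=X_{\alpha',\beta'}\ \text{for all } \alpha,\beta,\alpha',\beta'\in\mathbb{N}^{n+1}_d \text{ with } \alpha+\beta=\alpha'+\beta'\}$$ and $\mathcal{M}^{\mathsf{ps}}_{n+1,2d}=\mathcal{H}_{n+1,d}\cap\mathbb{S}^N_+$. For a convex set $C$ and $x\in C$, $\mathrm{minface}(x,C)$ is the minimal face of $C$ containing $x$. A property holds for generically chosen elements of the real vector space $(\mathbb{R}\times\mathbb{R}^n)^{\times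 s}$ if there is a Zariski-open dense subset on which it holds. "Almost surely" refers to the randomness of the matrices $B_k$ below. Extreme ray decomposition algorithm. Input: a nonempty spectrahedral cone $\mathcal{C}\subseteq\mathbb{S}^N$ (intersection of $\mathbb{S}^N_+$ with a linear subspace) and $0\neq X\in\mathcal{C}$. Set $k=1$, $X_1=X$. While $X_k\neq 0$: 1. $\mathcal{F}_k=\mathrm{minface}(X_k,\mathcal{C})$. 2. Draw a fresh random matrix $B_k$ (independently of the previous iterations) from any distribution on $\mathbb{S}^N$ that is absolutely continuous with respect to Lebesgue measure. 3. Choose $M_k\in\arg\min\{\langle B_k,Y\rangle : Y\in\mathcal{F}_k,\ \mathrm{tr}(Y)=1\}$. 4. Set $t_k=\sup\{t\ge 0: X_k-tM_k\in\mathcal{F}_k\}$. 5. Set $X_{k+1}=X_k-t_kM_k$ and increase $k$ by one. When the loop ends, return $r=k-1$ and $\{t_k,M_k\}_{k=1}^r$. *)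

theory Defs
  imports "HOL-Probability.Probability"
begin

section \<open>Multi-indices and monomial vectors\<close>

text \<open>The type \<^typ>\<open>'n option\<close> has \<open>n + 1\<close> elements; \<^term>\<open>None\<close> is the position of
  the homogenising coordinate.  An exponent \<open>\<alpha>\<close> of degree at most \<open>d\<close> in \<open>n\<close> variables
  corresponds to the homogeneous exponent with \<^term>\<open>None\<close>-component \<open>d - |\<alpha>|\<close>.\<close>

definition homog_exponents :: "nat \<Rightarrow> ('k::finite \<Rightarrow> nat) set" where
  "homog_exponents d = {\<alpha>. (\<Sum>i\<in>UNIV. \<alpha> i) = d}"

definition homogenize :: "real ^ 'n \<Rightarrow> real ^ ('n option)" where
  "homogenize z = (\<chi> i. case i of None \<Rightarrow> 1 | Some j \<Rightarrow> z $ j)"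

text \<open>Square matrices and vectors whose entries are labelled by \<open>homog_exponents d\<close> are
  modelled over a finite type \<^typ>\<open>'m\<close> together with an enumeration
  \<open>e :: 'm \<Rightarrow> ('k \<Rightarrow> nat)\<close>, which is meant to satisfy
  \<open>bij_betw e UNIV (homog_exponents d)\<close>.  This keeps the degree an ordinary number, and the
  graded lexicographic order is one such enumeration.\<close>

definition homog_monomials :: "('m::finite \<Rightarrow> 'k::finite \<Rightarrow> nat) \<Rightarrow> real ^ 'k \<Rightarrow> real ^ 'm" where
  "homog_monomials e u = (\<chi> a. \<Prod>i\<in>UNIV. (u $ i) ^ (e a i))"

definition monomials :: "('m::finite \<Rightarrow> 'n::finite option \<Rightarrow> nat) \<Rightarrow> real ^ 'n \<Rightarrow> real ^ 'm" where
  "monomials e z = homog_monomials e (homogenize z)"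


section \<open>Symmetric matrices and the pseudo-moment cone\<close>

definition outer :: "real ^ 'm \<Rightarrow> real ^ 'm ^ 'm" where
  "outer v = (\<chi> a b. v $ a * v $ b)"

definition sym_matrices :: "(real ^ 'm ^ 'm) set" where
  "sym_matrices = {A. transpose A = A}"

definition psd_matrices :: "(real ^ 'm ^ 'm) set" where
  "psd_matrices = {A \<in> sym_matrices. \<forall>x. 0 \<le> x \<bullet> (A *v x)}"

definition moment_matrices :: "('m::finite \<Rightarrow> 'k \<Rightarrow> nat) \<Rightarrow> (real ^ 'm ^ 'm) set" where
  "moment_matrices e = {X \<in> sym_matrices. \<forall>a b a' b'.
     (\<lambda>i. e a i + e b i) = (\<lambda>i. e a' i + e b' i) \<longrightarrow> X $ a $ b = X $ a' $ b'}"

definition pseudo_moment_cone :: "('m::finite \<Rightarrow> 'k \<Rightarrow> nat) \<Rightarrow> (real ^ 'm ^ 'm) set" where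
  "pseudo_moment_cone e = moment_matrices e \<inter> psd_matrices"

text \<open>Lebesgue measure on the space of symmetric matrices, in the coordinates given by the
  entries on and above the diagonal.  The entry at \<open>(a, b)\<close> and \<open>(b, a)\<close> is labelled by the
  set \<open>{a, b}\<close>, so that no order on the index type is needed.  As a measure on all matrices it is
  concentrated on \<^term>\<open>sym_matrices\<close>; hence so is every measure that is absolutely
  continuous with respect to it.\<close>

definition sym_coords :: "'m set set" where
  "sym_coords = range (\<lambda>(a, b). {a, b})"

definition sym_of_coords :: "('m set \<Rightarrow> real) \<Rightarrow> real ^ 'm ^ 'm" where
  "sym_of_coords x = (\<chi> a b. x {a, b})"

definition sym_lebesgue :: "(real ^ 'm::finite ^ 'm) measure" where
  "sym_lebesgue = distr (\<Pi>\<^sub>M c\<in>sym_coords. lborel) borel sym_of_coords"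

lemma measurable_sym_of_coords [measurable]:
  "(sym_of_coords :: ('m::finite set \<Rightarrow> real) \<Rightarrow> real ^ 'm ^ 'm)
     \<in> (\<Pi>\<^sub>M c\<in>sym_coords. lborel) \<rightarrow>\<^sub>M borel"
proof -
  have entry: "(\<lambda>x. x {a, b} :: real) \<in> borel_measurable (\<Pi>\<^sub>M c\<in>(sym_coords :: 'm set set). lborel)"
    for a b :: 'm
  proof -
    have "{a, b} \<in> (sym_coords :: 'm set set)"
      by (auto simp: sym_coords_def)
    from measurable_component_singleton[OF this, of "\<lambda>_. lborel :: real measure"]
    show ?thesis by simp
  qed
  show ?thesis
    unfolding borel_measurable_euclidean_space[of sym_of_coords]
    by (auto simp: Basis_vec_def inner_axis sym_of_coords_def intro!: entry)
qed

lemma sym_of_coords_sym: "sym_of_coords x \<in> sym_matrices"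
  by (simp add: sym_of_coords_def sym_matrices_def transpose_def vec_eq_iff insert_commute)

lemma sym_of_coords_surj:
  assumes "A \<in> sym_matrices"
  shows "\<exists>x \<in> space (\<Pi>\<^sub>M c\<in>sym_coords. lborel). sym_of_coords x = A"
proof -
  have sym: "A $ a $ b = A $ b $ a" for a b
    using assms by (auto simp: sym_matrices_def transpose_def vec_eq_iff)
  define x where "x = (\<lambda>c\<in>sym_coords. A $ fst (SOME p. c = {fst p, snd p})
                                         $ snd (SOME p. c = {fst p, snd p}))"
  have "x {a, b} = A $ a $ b" for a b
  proof -
    let ?p = "SOME p. {a, b} = {fst p, snd p}"
    have "{a, b} = {fst ?p, snd ?p}"
      by (rule someI[of "\<lambda>p. {a, b} = {fst p, snd p}" "(a, b)"]) simp
    then have "fst ?p = a \<and> snd ?p = b \<or> fst ?p = b \<and> snd ?p = a"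
      by (auto simp: doubleton_eq_iff)
    moreover have "{a, b} \<in> sym_coords"
      by (auto simp: sym_coords_def)
    ultimately show ?thesis
      using sym by (auto simp: x_def)
  qed
  then have "sym_of_coords x = A"
    by (simp add: sym_of_coords_def vec_eq_iff)
  moreover have "x \<in> space (\<Pi>\<^sub>M c\<in>sym_coords. lborel)"
    by (simp add: x_def space_PiM)
  ultimately show ?thesis by blast
qed


section \<open>Zariski topology of a real vector space\<close>

definition zariski :: "'a::euclidean_space topology" where
  "zariski = topology (\<lambda>U. \<exists>P. (\<forall>p\<in>P. real_polynomial_function p) \<and> U = {x. \<exists>p\<in>P. p x \<noteq> 0})"

lemma istopology_zariski:
  "istopology (\<lambda>U :: 'a::euclidean_space set.
     \<exists>P. (\<forall>p\<in>P. real_polynomial_function p) \<and> U = {x. \<exists>p\<in>P. p x \<noteq> 0})"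
  unfolding istopology_def
proof (intro conjI allI impI)
  fix S T :: "'a set"
  assume "\<exists>P. (\<forall>p\<in>P. real_polynomial_function p) \<and> S = {x. \<exists>p\<in>P. p x \<noteq> 0}"
     and "\<exists>P. (\<forall>p\<in>P. real_polynomial_function p) \<and> T = {x. \<exists>p\<in>P. p x \<noteq> 0}"
  then obtain P Q where P: "\<forall>p\<in>P. real_polynomial_function p" "S = {x. \<exists>p\<in>P. p x \<noteq> 0}"
    and Q: "\<forall>p\<in>Q. real_polynomial_function p" "T = {x. \<exists>p\<in>Q. p x \<noteq> 0}"
    by blast
  let ?R = "{(\<lambda>x. p x * q x) | p q. p \<in> P \<and> q \<in> Q}"
  have "\<forall>r\<in>?R. real_polynomial_function r"
    using P Q by auto
  moreover have "S \<inter> T = {x. \<exists>r\<in>?R. r x \<noteq> 0}"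
    unfolding P(2) Q(2)
    by auto (metis mult_eq_0_iff)
  ultimately show "\<exists>P. (\<forall>p\<in>P. real_polynomial_function p) \<and> S \<inter> T = {x. \<exists>p\<in>P. p x \<noteq> 0}"
    by blast
next
  fix K :: "'a set set"
  assume "\<forall>S\<in>K. \<exists>P. (\<forall>p\<in>P. real_polynomial_function p) \<and> S = {x. \<exists>p\<in>P. p x \<noteq> 0}"
  from bchoice[OF this] obtain P where P: "\<forall>S\<in>K. (\<forall>p\<in>P S. real_polynomial_function p) \<and>
      S = {x. \<exists>p\<in>P S. p x \<noteq> 0}" ..
  have "x \<in> S \<longleftrightarrow> (\<exists>p\<in>P S. p x \<noteq> 0)" if "S \<in> K" for x S
  proof -
    have "S = {x. \<exists>p\<in>P S. p x \<noteq> 0}"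
      using P that by blast
    from this[unfolded set_eq_iff, rule_format, of x] show ?thesis
      by simp
  qed
  then have "\<Union>K = {x. \<exists>p\<in>(\<Union>S\<in>K. P S). p x \<noteq> 0}"
    by auto
  moreover have "\<forall>p\<in>(\<Union>S\<in>K. P S). real_polynomial_function p"
    using P by blast
  ultimately show "\<exists>P. (\<forall>p\<in>P. real_polynomial_function p) \<and> \<Union>K = {x. \<exists>p\<in>P. p x \<noteq> 0}"
    by blast
qed

lemma openin_zariski:
  "openin zariski U \<longleftrightarrow>
     (\<exists>P. (\<forall>p\<in>P. real_polynomial_function p) \<and> U = {x. \<exists>p\<in>P. p x \<noteq> 0})"
  unfolding zariski_def by (simp add: topology_inverse'[OF istopology_zariski])

lemma topspace_zariski [simp]: "topspace zariski = UNIV"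
proof -
  have "openin zariski UNIV"
    unfolding openin_zariski by (rule exI[of _ "{\<lambda>x. 1}"]) auto
  then show ?thesis
    by (metis openin_subset top.extremum_uniqueI)
qed

definition generically :: "('a::euclidean_space \<Rightarrow> bool) \<Rightarrow> bool" where
  "generically P \<longleftrightarrow>
     (\<exists>U. openin zariski U \<and> zariski closure_of U = topspace zariski \<and> (\<forall>x\<in>U. P x))"


section \<open>The extreme ray decomposition algorithm\<close>

definition minface :: "'a::real_vector \<Rightarrow> 'a set \<Rightarrow> 'a set" where
  "minface x C = \<Inter>{F. F face_of C \<and> x \<in> F}"

text \<open>A state \<open>(ts, Y)\<close> consists of the list \<open>ts\<close> of pairs \<open>(t\<^sub>i, M\<^sub>i)\<close> produced so far and the
  current matrix \<open>Y = X\<^sub>k\<close>, where \<open>k = Suc (length ts)\<close>.  The matrix drawn in iteration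
  \<open>k \<ge> 1\<close> is \<open>B k\<close>.  The relation is nondeterministic because any minimiser may be chosen.\<close>

inductive erd_step :: "(real ^ 'm ^ 'm) set \<Rightarrow> (nat \<Rightarrow> real ^ 'm ^ 'm) \<Rightarrow>
    (real \<times> (real ^ 'm ^ 'm)) list \<times> (real ^ 'm ^ 'm) \<Rightarrow>
    (real \<times> (real ^ 'm ^ 'm)) list \<times> (real ^ 'm ^ 'm) \<Rightarrow> bool"
  for C :: "(real ^ 'm ^ 'm) set" and B :: "nat \<Rightarrow> real ^ 'm ^ 'm" where
  "erd_step C B (ts, Y) (ts @ [(t, M)], Y - t *\<^sub>R M)"
  if "Y \<noteq> 0"
    and "F = minface Y C"
    and "is_arg_min (\<lambda>Z. trace (B (Suc (length ts)) ** Z)) (\<lambda>Z. Z \<in> F \<and> trace Z = 1) M"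
    and "t = Sup {t. 0 \<le> t \<and> Y - t *\<^sub>R M \<in> F}"

definition erd_returns :: "(real ^ 'm ^ 'm) set \<Rightarrow> (nat \<Rightarrow> real ^ 'm ^ 'm) \<Rightarrow> real ^ 'm ^ 'm \<Rightarrow>
    (real \<times> (real ^ 'm ^ 'm)) list \<Rightarrow> bool" where
  "erd_returns C B X ts \<longleftrightarrow> (erd_step C B)\<^sup>*\<^sup>* ([], X) (ts, 0)"

text \<open>Whatever minimisers are chosen, the loop runs only finitely often and never gets stuck
  for lack of a minimiser.\<close>

definition erd_terminates :: "(real ^ 'm ^ 'm) set \<Rightarrow> (nat \<Rightarrow> real ^ 'm ^ 'm) \<Rightarrow>
    real ^ 'm ^ 'm \<Rightarrow> bool" where
  "erd_terminates C B X \<longleftrightarrow> termip (erd_step C B) ([], X) \<and>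
     (\<forall>ts Y. (erd_step C B)\<^sup>*\<^sup>* ([], X) (ts, Y) \<and> Y \<noteq> 0 \<longrightarrow> Ex (erd_step C B (ts, Y)))"

end

theory Submission
  imports Defs
begin

text \<open>A symmetric matrix \<open>q\<close> orthogonal to all moment matrices is a quadric that vanishes on the
  Veronese variety.  The bound on \<open>s\<close> leaves, for every pair \<open>i \<noteq> j\<close>, enough freedom for a nonzero
  such \<open>q\<close> with \<open>q v\<^sub>k = 0\<close> for all \<open>k \<noteq> i, j\<close>, where \<open>v\<^sub>k\<close> is the monomial vector of \<open>z\<^sub>k\<close>; for generic
  \<open>z\<^sub>i, z\<^sub>j\<close> it satisfies \<open>v\<^sub>i\<^sup>T q v\<^sub>j \<noteq> 0\<close>.  Hence the symmetrised products \<open>v\<^sub>i v\<^sub>j\<^sup>T + v\<^sub>j v\<^sub>i\<^sup>T\<close> with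
  \<open>i \<noteq> j\<close> are generically linearly independent modulo the moment matrices.  A matrix of the cone whose
  range lies in the span of the \<open>v\<^sub>i\<close> is therefore a combination of the \<open>v\<^sub>i v\<^sub>i\<^sup>T\<close> alone, so the
  minimal face of \<open>X\<close> is a simplicial cone.  Almost every linear functional has a unique minimiser
  on a simplex, namely a vertex, and each iteration removes one extreme ray.\<close>

section \<open>Polynomial functions and genericity\<close>

lemma real_polynomial_function_line:
  fixes p :: "'a::real_normed_vector \<Rightarrow> real"
  assumes "real_polynomial_function p"
  shows "real_polynomial_function (\<lambda>t::real. p (a + t *\<^sub>R b))"
proof -
  have "polynomial_function (\<lambda>t::real. a + t *\<^sub>R b)"
    by (intro polynomial_function_add polynomial_function_const
        polynomial_function_bounded_linear bounded_linear_scaleR_left)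
  from real_polynomial_function_compose[OF this assms] show ?thesis
    by (simp add: o_def)
qed

lemma finite_roots_real_polynomial_function:
  fixes p :: "real \<Rightarrow> real"
  assumes "real_polynomial_function p" "p a \<noteq> 0"
  shows "finite {t. p t = 0}"
proof -
  obtain c n where p: "p = (\<lambda>x. \<Sum>i\<le>n. c i * x ^ i)"
    using assms(1) real_polynomial_function_iff_sum by metis
  have "\<exists>k\<le>n. c k \<noteq> 0"
  proof (rule ccontr)
    assume "\<not> ?thesis"
    then show False
      using assms(2) by (simp add: p)
  qed
  then show ?thesis
    unfolding p by (rule polyfun_rootbound_finite)
qed

text \<open>On the line through \<open>a\<close> and \<open>b\<close>, both functions are univariate
  polynomials, one nonzero at \<open>t = 0\<close>, the other at \<open>t = 1\<close>; so only
  finitely many \<open>t\<close> are bad. This is how separate genericity conditions are met at one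
  common point.\<close>

lemma real_polynomial_functions_nonzero_on_line:
  fixes p q :: "'a::real_normed_vector \<Rightarrow> real"
  assumes "real_polynomial_function p" "real_polynomial_function q" "p a \<noteq> 0" "q b \<noteq> 0"
  obtains t where "p (a + t *\<^sub>R (b - a)) \<noteq> 0" "q (a + t *\<^sub>R (b - a)) \<noteq> 0"
proof -
  let ?p = "\<lambda>t. p (a + t *\<^sub>R (b - a))" and ?q = "\<lambda>t. q (a + t *\<^sub>R (b - a))"
  have "finite {t. ?p t = 0}"
    by (rule finite_roots_real_polynomial_function[of _ 0])
      (use assms in \<open>simp_all add: real_polynomial_function_line\<close>)
  moreover have "finite {t. ?q t = 0}"
    by (rule finite_roots_real_polynomial_function[of _ 1])
      (use assms in \<open>simp_all add: real_polynomial_function_line\<close>)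
  ultimately have "finite ({t. ?p t = 0} \<union> {t. ?q t = 0})"
    by simp
  then obtain t where "t \<notin> {t. ?p t = 0} \<union> {t. ?q t = 0}"
    using ex_new_if_finite[OF infinite_UNIV_char_0] by metis
  then show ?thesis
    by (intro that[of t]) auto
qed

text \<open>One polynomial that is not identically zero suffices: by the line argument its
  nonvanishing set meets every nonempty Zariski open set.\<close>

lemma genericallyI:
  fixes p :: "'a::euclidean_space \<Rightarrow> real"
  assumes p: "real_polynomial_function p" "p a \<noteq> 0"
    and P: "\<And>x. p x \<noteq> 0 \<Longrightarrow> P x"
  shows "generically P"
proof -
  let ?U = "{x. p x \<noteq> 0}"
  have U: "openin zariski ?U"
    unfolding openin_zariski by (rule exI[of _ "{p}"]) (use p in auto)
  have "zariski closure_of ?U = topspace zariski"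
  proof -
    have "?U \<inter> V \<noteq> {}" if "openin zariski V" "V \<noteq> {}" for V
    proof -
      obtain Q where Q: "\<forall>q\<in>Q. real_polynomial_function q" "V = {x. \<exists>q\<in>Q. q x \<noteq> 0}"
        using \<open>openin zariski V\<close> unfolding openin_zariski by auto
      with \<open>V \<noteq> {}\<close> obtain q b where q: "q \<in> Q" "q b \<noteq> 0"
        by auto
      then have "real_polynomial_function q"
        using Q by simp
      from real_polynomial_functions_nonzero_on_line[OF p(1) this p(2) q(2)]
      obtain t where "p (a + t *\<^sub>R (b - a)) \<noteq> 0" "q (a + t *\<^sub>R (b - a)) \<noteq> 0" .
      then show ?thesis
        using q Q by auto
    qed
    then show ?thesis
      unfolding dense_intersects_open by simp
  qed
  then show ?thesis
    unfolding generically_def using U P by auto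
qed

section \<open>Counting exponents and independence of monomials\<close>

lemma card_homog_exponents:
  "card (homog_exponents d :: ('k::finite \<Rightarrow> nat) set) = (CARD('k) + d - 1) choose d"
proof -
  have size: "size A = (\<Sum>i\<in>UNIV. count A i)" for A :: "'k multiset"
    unfolding size_multiset_overloaded_eq
    by (rule sum.mono_neutral_left) (auto simp: not_in_iff)
  have "homog_exponents d = count ` multisets_of_size (UNIV :: 'k set) d"
  proof (intro set_eqI iffI)
    fix \<alpha> :: "'k \<Rightarrow> nat"
    assume "\<alpha> \<in> homog_exponents d"
    moreover have "count (Abs_multiset \<alpha>) = \<alpha>"
      by (rule Abs_multiset_inverse) simp
    ultimately show "\<alpha> \<in> count ` multisets_of_size UNIV d"
      by (intro image_eqI[of _ _ "Abs_multiset \<alpha>"])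
        (auto simp: multisets_of_size_def size homog_exponents_def)
  qed (auto simp: multisets_of_size_def size homog_exponents_def)
  moreover have "inj_on count (multisets_of_size (UNIV :: 'k set) d)"
    by (simp add: inj_on_def count_inject)
  ultimately have "card (homog_exponents d :: ('k \<Rightarrow> nat) set) =
      card (multisets_of_size (UNIV :: 'k set) d)"
    by (simp add: card_image)
  then show ?thesis
    by (simp add: card_multisets_of_size)
qed

text \<open>Induction over the variables: as a polynomial in \<open>x j\<close> alone the sum
  vanishes coefficientwise, and each coefficient is a relation between monomials in the remaining
  variables.\<close>

lemma monomials_independent:
  fixes c :: "'i \<Rightarrow> real" and \<alpha> :: "'i \<Rightarrow> 'k \<Rightarrow> nat"
  assumes "finite A" "finite I"
    and "\<And>a b. a \<in> I \<Longrightarrow> b \<in> I \<Longrightarrow> (\<And>j. j \<in> A \<Longrightarrow> \<alpha> a j = \<alpha> b j) \<Longrightarrow> a = b"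
    and "\<And>x :: 'k \<Rightarrow> real. (\<Sum>a\<in>I. c a * (\<Prod>j\<in>A. x j ^ \<alpha> a j)) = 0"
    and "a \<in> I"
  shows "c a = 0"
  using assms
proof (induction A arbitrary: I a rule: finite_induct)
  case empty
  then have "I = {a}"
    by auto
  then show ?case
    using empty.prems by simp
next
  case (insert j A)
  define n where "n = Max ((\<lambda>a. \<alpha> a j) ` I)"
  have n: "\<alpha> b j \<le> n" if "b \<in> I" for b
    unfolding n_def using that insert.prems by simp
  define I' where "I' = {b \<in> I. \<alpha> b j = \<alpha> a j}"
  show ?case
  proof (rule insert.IH[of I'])
    show "finite I'" "a \<in> I'"
      using insert.prems by (auto simp: I'_def)
    show "b = b'" if "b \<in> I'" "b' \<in> I'" "\<And>j. j \<in> A \<Longrightarrow> \<alpha> b j = \<alpha> b' j" for b b'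
      by (rule insert.prems(2)) (use that in \<open>auto simp: I'_def\<close>)
    show "(\<Sum>b\<in>I'. c b * (\<Prod>j\<in>A. x j ^ \<alpha> b j)) = 0" for x :: "'k \<Rightarrow> real"
    proof -
      let ?s = "\<lambda>k. \<Sum>b\<in>{b\<in>I. \<alpha> b j = k}. c b * (\<Prod>j\<in>A. x j ^ \<alpha> b j)"
      have "(\<Sum>k\<le>n. ?s k * t ^ k) = 0" for t
      proof -
        have "(\<Sum>k\<le>n. ?s k * t ^ k) =
            (\<Sum>k\<le>n. \<Sum>b\<in>{b\<in>I. \<alpha> b j = k}. c b * (t ^ \<alpha> b j * (\<Prod>j\<in>A. x j ^ \<alpha> b j)))"
          by (auto simp: sum_distrib_right intro!: sum.cong)
        also have "\<dots> = (\<Sum>b\<in>I. c b * (t ^ \<alpha> b j * (\<Prod>j\<in>A. x j ^ \<alpha> b j)))"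
          by (rule sum.group) (use n insert.prems in auto)
        also have "\<dots> = (\<Sum>b\<in>I. c b * (\<Prod>i\<in>insert j A. (x(j := t)) i ^ \<alpha> b i))"
        proof (intro sum.cong refl)
          fix b
          have "(\<Prod>i\<in>A. (x(j := t)) i ^ \<alpha> b i) = (\<Prod>i\<in>A. x i ^ \<alpha> b i)"
            using insert.hyps by (intro prod.cong) auto
          then show "c b * (t ^ \<alpha> b j * (\<Prod>j\<in>A. x j ^ \<alpha> b j)) =
              c b * (\<Prod>i\<in>insert j A. (x(j := t)) i ^ \<alpha> b i)"
            using insert.hyps by simp
        qed
        also have "\<dots> = 0"
          by (rule insert.prems(3))
        finally show ?thesis .
      qed
      then have "?s (\<alpha> a j) = 0"
        using polyfun_eq_0[of ?s n] n[OF \<open>a \<in> I\<close>] by simp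
      then show ?thesis
        by (simp add: I'_def)
    qed
  qed
qed

section \<open>Quadrics on the Veronese variety\<close>

definition rank_one :: "real ^ 'm \<Rightarrow> real ^ 'm \<Rightarrow> real ^ 'm ^ 'm" where
  "rank_one u v = (\<chi> a b. u $ a * v $ b)"

lemma outer_eq_rank_one: "outer v = rank_one v v"
  by (simp add: outer_def rank_one_def)

lemma inner_matrix: "(A :: real ^ 'n ^ 'm) \<bullet> Y = (\<Sum>a\<in>UNIV. \<Sum>b\<in>UNIV. A $ a $ b * Y $ a $ b)"
  by (simp add: inner_vec_def)

lemma inner_rank_one: "A \<bullet> rank_one u v = u \<bullet> (A *v v)"
  by (simp add: inner_vec_def rank_one_def matrix_vector_mult_def sum_distrib_left algebra_simps)

lemma inner_symmetric_matrix:
  assumes "A \<in> sym_matrices"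
  shows "x \<bullet> (A *v y) = (A *v x) \<bullet> y"
  using assms by (simp add: sym_matrices_def dot_lmul_matrix[symmetric]
      flip: transpose_matrix_vector)

lemma moment_matrices_iff:
  "X \<in> moment_matrices e \<longleftrightarrow> (\<forall>a b a' b'.
     (\<lambda>i. e a i + e b i) = (\<lambda>i. e a' i + e b' i) \<longrightarrow> X $ a $ b = X $ a' $ b')"
  (is "_ \<longleftrightarrow> ?R")
proof
  assume R: ?R
  have "X $ a $ b = X $ b $ a" for a b
    by (rule R[rule_format]) (simp add: add.commute)
  then have "X \<in> sym_matrices"
    by (simp add: sym_matrices_def transpose_def vec_eq_iff)
  with R show "X \<in> moment_matrices e"
    unfolding moment_matrices_def by (intro CollectI conjI)
qed (unfold moment_matrices_def, elim CollectE conjE)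

lemma subspace_moment_matrices: "subspace (moment_matrices e)"
proof (rule subspaceI)
  show "0 \<in> moment_matrices e"
    by (simp add: moment_matrices_iff)
  fix x y and r :: real
  assume x: "x \<in> moment_matrices e"
  show "r *\<^sub>R x \<in> moment_matrices e"
    unfolding moment_matrices_iff
  proof (intro allI impI)
    fix a b a' b'
    assume "(\<lambda>i. e a i + e b i) = (\<lambda>i. e a' i + e b' i)"
    with x have "x $ a $ b = x $ a' $ b'"
      unfolding moment_matrices_iff by blast
    then show "(r *\<^sub>R x) $ a $ b = (r *\<^sub>R x) $ a' $ b'"
      by simp
  qed
  assume y: "y \<in> moment_matrices e"
  show "x + y \<in> moment_matrices e"
    unfolding moment_matrices_iff
  proof (intro allI impI)
    fix a b a' b'
    assume "(\<lambda>i. e a i + e b i) = (\<lambda>i. e a' i + e b' i)"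
    with x y have "x $ a $ b = x $ a' $ b'" "y $ a $ b = y $ a' $ b'"
      unfolding moment_matrices_iff by blast+
    then show "(x + y) $ a $ b = (x + y) $ a' $ b'"
      by simp
  qed
qed

lemma outer_homog_monomials_moment: "outer (homog_monomials e u) \<in> moment_matrices e"
proof -
  have "homog_monomials e u $ a * homog_monomials e u $ b = (\<Prod>i\<in>UNIV. u $ i ^ (e a i + e b i))"
    for a b
    by (simp add: homog_monomials_def power_add prod.distrib)
  then show ?thesis
    by (simp add: moment_matrices_iff outer_def fun_eq_iff)
qed

lemma outer_psd: "outer v \<in> psd_matrices"
proof -
  have "x \<bullet> (outer v *v x) = (x \<bullet> v)\<^sup>2" for x
    by (simp add: inner_vec_def outer_def matrix_vector_mult_def sum_distrib_left
        sum_distrib_right power2_eq_square algebra_simps)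
  then show ?thesis
    by (simp add: psd_matrices_def sym_matrices_def transpose_def outer_def vec_eq_iff mult.commute)
qed

text \<open>The matrices in the orthogonal complement of \<open>moment_matrices e\<close> are the quadrics that
  vanish on the Veronese variety.\<close>

lemma exists_vanishing_quadric:
  fixes e :: "'m::finite \<Rightarrow> 'k \<Rightarrow> nat" and v :: "'s \<Rightarrow> real ^ 'm"
  assumes "finite K"
    and count: "card (range (\<lambda>(a, b) i. e a i + e b i)) + card K * CARD('m) + (CARD('m) choose 2)
      < CARD('m) * CARD('m)"
  obtains q where "q \<noteq> 0" "q \<in> sym_matrices" "\<And>k. k \<in> K \<Longrightarrow> q *v v k = 0"
    "\<And>Y. Y \<in> moment_matrices e \<Longrightarrow> q \<bullet> Y = 0"
proof -
  let ?deg = "\<lambda>(a, b) i. e a i + e b i"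
  \<comment> \<open>The matrices \<open>E \<gamma>\<close> span the moment matrices. Orthogonality
    to \<open>R (k, a)\<close> says that entry \<open>a\<close> of \<open>q *v v k\<close> is zero,
    and orthogonality to \<open>T P\<close> that the two entries of \<open>q\<close> at the pair
    \<open>P\<close> agree; \<open>SOME\<close> merely fixes the sign of \<open>T P\<close>.\<close>
  define E :: "('k \<Rightarrow> nat) \<Rightarrow> real ^ 'm ^ 'm"
    where "E \<gamma> = (\<chi> a b. if ?deg (a, b) = \<gamma> then 1 else 0)" for \<gamma>
  define R where "R = (\<lambda>(k, a). rank_one (axis a 1) (v k))"
  define T :: "'m set \<Rightarrow> real ^ 'm ^ 'm" where "T P = (let p = SOME p. P = {fst p, snd p} in
    rank_one (axis (fst p) 1) (axis (snd p) 1) - rank_one (axis (snd p) 1) (axis (fst p) 1))" for P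
  let ?pairs = "{P :: 'm set. card P = 2}"
  let ?S = "E ` range ?deg \<union> R ` (K \<times> UNIV) \<union> T ` ?pairs"
  have fin: "finite (range ?deg)" "finite (K \<times> (UNIV :: 'm set))" "finite ?pairs"
    using assms(1) by auto
  have "card ?pairs = CARD('m) choose 2"
    using n_subsets[of "UNIV :: 'm set" 2] by simp
  moreover have "card ?S \<le> card (E ` range ?deg) + card (R ` (K \<times> UNIV)) + card (T ` ?pairs)"
    by (intro order_trans[OF card_Un_le] add_right_mono card_Un_le)
  moreover have "card (E ` range ?deg) \<le> card (range ?deg)"
    "card (R ` (K \<times> UNIV)) \<le> card K * CARD('m)" "card (T ` ?pairs) \<le> card ?pairs"
    using card_image_le[OF fin(1), of E] card_image_le[OF fin(2), of R]
      card_image_le[OF fin(3), of T] by (simp_all add: card_cartesian_product)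
  ultimately have "card ?S < CARD('m) * CARD('m)"
    using count by linarith
  moreover have "finite ?S"
    using fin by simp
  ultimately have "dim ?S < DIM(real ^ 'm ^ 'm)"
    using dim_le_card'[of ?S] by simp
  \<comment> \<open>Fewer generators than matrix entries leave a nonzero orthogonal
    direction.\<close>
  then obtain q where q: "q \<noteq> 0" "\<And>y. y \<in> span ?S \<Longrightarrow> orthogonal q y"
    using orthogonal_to_subspace_exists by blast
  have qS: "q \<bullet> y = 0" if "y \<in> ?S" for y
    using q(2)[OF span_base[OF that]] by (simp add: orthogonal_def)
  have entry: "q \<bullet> rank_one (axis a 1) (axis b 1) = q $ a $ b" for a b
    by (simp add: inner_rank_one inner_axis' matrix_vector_mult_basis column_def)
  have "q $ a $ b = q $ b $ a" for a b
  proof (cases "a = b")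
    case False
    let ?p = "SOME p. {a, b} = {fst p, snd p}"
    have "{a, b} = {fst ?p, snd ?p}"
      by (rule someI[of "\<lambda>p. {a, b} = {fst p, snd p}" "(a, b)"]) simp
    then have "?p = (a, b) \<or> ?p = (b, a)"
      by (auto simp: doubleton_eq_iff prod_eq_iff)
    moreover have "q \<bullet> T {a, b} = 0"
      using False by (intro qS) auto
    ultimately show ?thesis
      by (auto simp: T_def Let_def inner_diff_right entry)
  qed simp
  then have sym: "q \<in> sym_matrices"
    by (simp add: sym_matrices_def transpose_def vec_eq_iff)
  have ker: "q *v v k = 0" if "k \<in> K" for k
  proof -
    have "(q *v v k) $ a = q \<bullet> R (k, a)" for a
      by (simp add: R_def inner_rank_one inner_axis')
    moreover have "q \<bullet> R (k, a) = 0" for a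
      using that by (intro qS) auto
    ultimately show ?thesis
      by (simp add: vec_eq_iff)
  qed
  have "q \<bullet> Y = 0" if Y: "Y \<in> moment_matrices e" for Y
  proof -
    \<comment> \<open>\<open>y \<gamma>\<close> reads the common entry of \<open>Y\<close> along
      \<open>\<gamma>\<close> at an arbitrary representative; these are the coordinates of
      \<open>Y\<close> in the matrices \<open>E \<gamma>\<close>.\<close>
    define y where "y \<gamma> = (let p = SOME p. ?deg p = \<gamma> in Y $ fst p $ snd p)" for \<gamma>
    have y: "y (?deg (a, b)) = Y $ a $ b" for a b
    proof -
      let ?p = "SOME p. ?deg p = ?deg (a, b)"
      have "?deg ?p = ?deg (a, b)"
        by (rule someI[of "\<lambda>p. ?deg p = ?deg (a, b)" "(a, b)"]) simp
      then have "(\<lambda>i. e (fst ?p) i + e (snd ?p) i) = (\<lambda>i. e a i + e b i)"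
        unfolding case_prod_beta fst_conv snd_conv .
      with Y have "Y $ fst ?p $ snd ?p = Y $ a $ b"
        unfolding moment_matrices_iff by blast
      then show ?thesis
        by (simp add: y_def Let_def)
    qed
    have "Y = (\<Sum>\<gamma>\<in>range ?deg. y \<gamma> *\<^sub>R E \<gamma>)"
    proof -
      have "(\<Sum>\<gamma>\<in>range ?deg. y \<gamma> *\<^sub>R E \<gamma>) $ a $ b = Y $ a $ b" for a b
      proof -
        have "(\<Sum>\<gamma>\<in>range ?deg. y \<gamma> *\<^sub>R E \<gamma>) $ a $ b =
            (\<Sum>\<gamma>\<in>range ?deg. if \<gamma> = ?deg (a, b) then y \<gamma> else 0)"
          unfolding sum_component by (intro sum.cong) (auto simp: E_def)
        also have "\<dots> = y (?deg (a, b))"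
          by (subst sum.delta) (use fin(1) in auto)
        finally show ?thesis
          using y by simp
      qed
      then show ?thesis
        by (simp add: vec_eq_iff)
    qed
    then have "q \<bullet> Y = (\<Sum>\<gamma>\<in>range ?deg. y \<gamma> * (q \<bullet> E \<gamma>))"
      by (simp add: inner_sum_right)
    also have "\<dots> = 0"
      using qS by (intro sum.neutral) auto
    finally show ?thesis .
  qed
  then show ?thesis
    using that q(1) sym ker by blast
qed

section \<open>Generic independence of symmetrised products\<close>

text \<open>Independence of a family, not of its set of values: a repeated vector counts as a
  dependence.\<close>

definition indexed_independent :: "'p set \<Rightarrow> ('p \<Rightarrow> 'a::real_vector) \<Rightarrow> bool" where
  "indexed_independent S R \<longleftrightarrow> (\<forall>c. (\<Sum>p\<in>S. c p *\<^sub>R R p) = 0 \<longrightarrow> (\<forall>p\<in>S. c p = 0))"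

text \<open>Padding the Gram matrix of a subfamily with an identity block keeps the index type fixed.\<close>

definition gram_matrix :: "'p set \<Rightarrow> ('p \<Rightarrow> 'a::real_inner) \<Rightarrow> real ^ 'p ^ 'p" where
  "gram_matrix S R =
     (\<chi> p p'. if p \<in> S \<and> p' \<in> S then R p \<bullet> R p' else if p = p' then 1 else 0)"

lemma gram_matrix_vector_mult:
  fixes S :: "'p::finite set"
  shows "(gram_matrix S R *v x) $ p =
    (if p \<in> S then R p \<bullet> (\<Sum>p'\<in>S. x $ p' *\<^sub>R R p') else x $ p)"
proof (cases "p \<in> S")
  case True
  then have "(gram_matrix S R *v x) $ p = (\<Sum>p'\<in>UNIV. if p' \<in> S then x $ p' * (R p \<bullet> R p') else 0)"
    unfolding matrix_vector_mult_def gram_matrix_def by (auto intro!: sum.cong)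
  then show ?thesis
    using True by (simp add: inner_sum_right sum.If_cases)
next
  case False
  then have "(gram_matrix S R *v x) $ p = (\<Sum>p'\<in>UNIV. if p' = p then x $ p' else 0)"
    by (simp add: matrix_vector_mult_def gram_matrix_def mult_delta_left eq_commute[of p])
  then show ?thesis
    using False by simp
qed

text \<open>A kernel vector \<open>x\<close> gives a combination of the \<open>R p\<close> that is
  orthogonal to each \<open>R p\<close>, hence to itself, hence zero. Independence thus becomes the
  nonvanishing of a single determinant.\<close>

lemma det_gram_matrix_nonzero_iff:
  fixes S :: "'p::finite set"
  shows "det (gram_matrix S R) \<noteq> 0 \<longleftrightarrow> indexed_independent S R"
proof -
  have "det (gram_matrix S R) \<noteq> 0 \<longleftrightarrow> (\<forall>x. gram_matrix S R *v x = 0 \<longrightarrow> x = 0)"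
    by (simp add: invertible_det_nz[symmetric] invertible_left_inverse matrix_left_invertible_ker)
  also have "\<dots> \<longleftrightarrow> indexed_independent S R"
  proof
    assume ker: "\<forall>x. gram_matrix S R *v x = 0 \<longrightarrow> x = 0"
    show "indexed_independent S R"
      unfolding indexed_independent_def
    proof (intro allI impI ballI)
      fix c p
      assume c: "(\<Sum>p\<in>S. c p *\<^sub>R R p) = 0" and p: "p \<in> S"
      define x where "x = (\<chi> p. if p \<in> S then c p else 0)"
      have "(\<Sum>p'\<in>S. x $ p' *\<^sub>R R p') = 0"
        using c by (simp add: x_def)
      then have "gram_matrix S R *v x = 0"
        by (simp add: vec_eq_iff gram_matrix_vector_mult) (simp add: x_def)
      then have "x $ p = 0"
        using ker by (metis zero_index)
      then show "c p = 0"
        using p by (simp add: x_def)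
    qed
  next
    assume indep: "indexed_independent S R"
    show "\<forall>x. gram_matrix S R *v x = 0 \<longrightarrow> x = 0"
    proof (intro allI impI)
      fix x
      assume "gram_matrix S R *v x = 0"
      then have x: "(if p \<in> S then R p \<bullet> (\<Sum>p'\<in>S. x $ p' *\<^sub>R R p') else x $ p) = 0" for p
        using gram_matrix_vector_mult[of S R x p] by simp
      let ?y = "\<Sum>p'\<in>S. x $ p' *\<^sub>R R p'"
      have "?y \<bullet> ?y = (\<Sum>p\<in>S. x $ p * (R p \<bullet> ?y))"
        by (subst inner_sum_left) simp
      also have "\<dots> = 0"
        using x by (intro sum.neutral) (metis mult_zero_right)
      finally have "?y = 0"
        by simp
      then have "x $ p = 0" if "p \<in> S" for p
        using indep that unfolding indexed_independent_def by blast
      moreover have "x $ p = 0" if "p \<notin> S" for p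
        using x[of p] that by simp
      ultimately show "x = 0"
        unfolding vec_eq_iff zero_index by blast
    qed
  qed
  finally show ?thesis .
qed

lemma real_polynomial_function_det_gram_matrix:
  fixes S :: "'p::finite set"
  assumes "\<And>p p'. real_polynomial_function (\<lambda>x. R x p \<bullet> R x p')"
  shows "real_polynomial_function (\<lambda>x. det (gram_matrix S (R x)))"
proof -
  have "real_polynomial_function (\<lambda>x. gram_matrix S (R x) $ p $ p')" for p p'
    unfolding gram_matrix_def vec_lambda_beta
    by (cases "p \<in> S \<and> p' \<in> S"; cases "p = p'")
      (simp_all only: if_True if_False simp_thms assms real_polynomial_function.intros(2))
  then show ?thesis
    unfolding det_def
    by (intro real_polynomial_function_sum real_polynomial_function.intros(4)
        real_polynomial_function_prod real_polynomial_function.intros(2) finite_permutations finite)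
qed

section \<open>Monomial vectors and their symmetrised products modulo moment matrices\<close>

lemma sum_UNIV_option: "(\<Sum>i\<in>UNIV. f i) = f None + (\<Sum>j\<in>UNIV. f (Some j))"
  for f :: "'n::finite option \<Rightarrow> 'a::comm_monoid_add"
  by (simp add: UNIV_option_conv sum.reindex)

lemma monomials_component: "monomials e z $ a = (\<Prod>j\<in>UNIV. z $ j ^ e a (Some j))"
  by (simp add: monomials_def homog_monomials_def homogenize_def UNIV_option_conv prod.reindex)

text \<open>A hyperplane through the origin containing all monomial vectors would be a linear
  relation between distinct monomials in \<open>n\<close> variables.\<close>

lemma monomials_spanning:
  fixes e :: "'m::finite \<Rightarrow> 'n::finite option \<Rightarrow> nat"
  assumes e: "bij_betw e UNIV (homog_exponents d)" and c: "\<And>z. c \<bullet> monomials e z = 0"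
  shows "c = 0"
proof -
  \<comment> \<open>The total degree \<open>d\<close> determines the \<open>None\<close> component,
    so distinct exponents stay distinct when it is dropped.\<close>
  have eq: "a = b" if "\<And>j. e a (Some j) = e b (Some j)" for a b
  proof -
    have "e a \<in> homog_exponents d" "e b \<in> homog_exponents d"
      using e by (auto simp: bij_betw_def)
    then have "e a None = e b None"
      using that by (simp add: homog_exponents_def sum_UNIV_option)
    with that have "e a i = e b i" for i
      by (cases i) simp_all
    then have "e a = e b"
      by (simp add: fun_eq_iff)
    then show ?thesis
      using e by (auto simp: bij_betw_def dest: injD)
  qed
  have "c $ a = 0" for a
  proof (rule monomials_independent[of "UNIV :: 'n set" "UNIV :: 'm set" "\<lambda>a j. e a (Some j)"])
    fix x :: "'n \<Rightarrow> real"
    show "(\<Sum>a\<in>UNIV. c $ a * (\<Prod>j\<in>UNIV. x j ^ e a (Some j))) = 0"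
      using c[of "\<chi> j. x j"] by (simp add: inner_vec_def monomials_component)
  qed (use eq in auto)
  then show ?thesis
    by (simp add: vec_eq_iff)
qed

text \<open>The monomial vectors span the space, so a bilinear form vanishing on all pairs of them
  is zero; the two arguments are treated one after the other.\<close>

lemma exists_monomials_bilinear_nonzero:
  fixes e :: "'m::finite \<Rightarrow> 'n::finite option \<Rightarrow> nat"
  assumes e: "bij_betw e UNIV (homog_exponents d)" and "q \<noteq> 0"
  obtains x y where "monomials e x \<bullet> (q *v monomials e y) \<noteq> 0"
proof (rule ccontr)
  assume "\<not> thesis"
  then have "monomials e x \<bullet> (q *v monomials e y) = 0" for x y
    using that by blast
  then have "q *v monomials e y = 0" for y
    using monomials_spanning[OF e] by (simp add: inner_commute)
  then have "q $ a \<bullet> monomials e y = 0" for a y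
    by (metis matrix_mult_dot vec_lambda_beta zero_index)
  then have "q $ a = 0" for a
    using monomials_spanning[OF e] by blast
  then show False
    using \<open>q \<noteq> 0\<close> by (simp add: vec_eq_iff)
qed

definition sym_outer :: "real ^ 'm \<Rightarrow> real ^ 'm \<Rightarrow> real ^ 'm ^ 'm" where
  "sym_outer u v = rank_one u v + rank_one v u"

lemma inner_sym_outer:
  assumes "q \<in> sym_matrices"
  shows "q \<bullet> sym_outer u v = 2 * (u \<bullet> (q *v v))"
  using inner_symmetric_matrix[OF assms, of u v]
  by (simp add: sym_outer_def inner_add_right inner_rank_one inner_commute)

text \<open>A linear map with kernel the moment matrices, standing in for the quotient map:
  independence modulo moment matrices becomes ordinary independence of images, whose entries are
  linear in those of \<open>A\<close>.\<close>

definition hankel_defect ::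
    "('m::finite \<Rightarrow> 'k \<Rightarrow> nat) \<Rightarrow> real ^ 'm ^ 'm \<Rightarrow> real ^ 'm ^ 'm ^ 'm ^ 'm" where
  "hankel_defect e A = (\<chi> a b a' b'.
     if (\<lambda>i. e a i + e b i) = (\<lambda>i. e a' i + e b' i) then A $ a $ b - A $ a' $ b' else 0)"

lemma linear_hankel_defect: "linear (hankel_defect e)"
  by (rule linearI) (simp_all add: hankel_defect_def vec_eq_iff algebra_simps)

lemma hankel_defect_eq_0_iff: "hankel_defect e A = 0 \<longleftrightarrow> A \<in> moment_matrices e"
  unfolding moment_matrices_iff hankel_defect_def vec_eq_iff
  by (simp del: fun_eq_iff add: if_distrib)

lemma hankel_defect_sum:
  "(\<Sum>p\<in>S. c p *\<^sub>R hankel_defect e (A p)) = hankel_defect e (\<Sum>p\<in>S. c p *\<^sub>R A p)"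
  by (simp add: linear_sum[OF linear_hankel_defect] linear_cmul[OF linear_hankel_defect])

lemma real_polynomial_function_monomials:
  "real_polynomial_function (\<lambda>wz :: (real \<times> (real ^ 'n::finite)) ^ 's::finite.
     monomials e (snd (wz $ i)) $ a)"
proof -
  have "bounded_linear (\<lambda>wz :: (real \<times> (real ^ 'n)) ^ 's. snd (wz $ i) $ j)" for j
    by (intro bounded_linear_compose[OF bounded_linear_vec_nth]
        bounded_linear_compose[OF bounded_linear_snd] bounded_linear_vec_nth)
  then show ?thesis
    unfolding monomials_component
    by (intro real_polynomial_function_prod real_polynomial_function_power
        real_polynomial_function.intros(1) finite)
qed

lemma real_polynomial_function_hankel_defect_inner:
  assumes A: "\<And>p a b. real_polynomial_function (\<lambda>x. A x p $ a $ b)"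
  shows "real_polynomial_function (\<lambda>x. hankel_defect e (A x p) \<bullet> hankel_defect e (A x p'))"
proof -
  have "real_polynomial_function (\<lambda>x. hankel_defect e (A x p) $ a $ b $ a' $ b')" for p a b a' b'
    unfolding hankel_defect_def vec_lambda_beta
    by (cases "(\<lambda>i. e a i + e b i) = (\<lambda>i. e a' i + e b' i)")
      (simp_all only: if_True if_False simp_thms real_polynomial_function_diff[OF A A] real_polynomial_function.intros(2))
  then show ?thesis
    unfolding inner_vec_def inner_real_def
    by (intro real_polynomial_function_sum real_polynomial_function.intros(4) finite)
qed

definition pair_defect :: "('m::finite \<Rightarrow> 'n::finite option \<Rightarrow> nat) \<Rightarrow>
    (real \<times> (real ^ 'n)) ^ 's::finite \<Rightarrow> 's \<times> 's \<Rightarrow> real ^ 'm ^ 'm ^ 'm ^ 'm" where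
  "pair_defect e wz p = hankel_defect e
     (sym_outer (monomials e (snd (wz $ fst p))) (monomials e (snd (wz $ snd p))))"

lemma real_polynomial_function_det_pair_defect:
  "real_polynomial_function (\<lambda>wz. det (gram_matrix S (pair_defect e wz)))"
  unfolding pair_defect_def
  by (intro real_polynomial_function_det_gram_matrix real_polynomial_function_hankel_defect_inner)
    (simp only: sym_outer_def rank_one_def vector_add_component vec_lambda_beta,
      intro real_polynomial_function.intros(3) real_polynomial_function.intros(4)
        real_polynomial_function_monomials)

text \<open>A quadric \<open>q\<close> that vanishes on the Veronese variety and is singular at all points but the
  \<open>i\<close>-th and the \<open>j\<close>-th detects the pair \<open>(i, j)\<close> and no other pair.\<close>

lemma exists_independent_pair_defects:
  fixes e :: "'m::finite \<Rightarrow> 'n::finite option \<Rightarrow> nat" and h :: "'s::finite \<Rightarrow> nat"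
  assumes e: "bij_betw e UNIV (homog_exponents d)"
    and count: "card (range (\<lambda>(a, b) i. e a i + e b i)) + (CARD('s) - 2) * CARD('m) +
      (CARD('m) choose 2) < CARD('m) * CARD('m)"
    and "S \<subseteq> {(i, j). h i < h j}"
  shows "\<exists>wz :: (real \<times> (real ^ 'n)) ^ 's. indexed_independent S (pair_defect e wz)"
  using finite[of S] assms(3)
proof (induction S rule: finite_induct)
  case empty
  then show ?case
    by (simp add: indexed_independent_def)
next
  case (insert p S)
  obtain i j where p: "p = (i, j)" and ij: "h i < h j"
    using insert.prems by auto
  obtain wz0 :: "(real \<times> (real ^ 'n)) ^ 's" where "indexed_independent S (pair_defect e wz0)"
    using insert by auto
  then have G0: "det (gram_matrix S (pair_defect e wz0)) \<noteq> 0"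
    by (simp add: det_gram_matrix_nonzero_iff)
  let ?v = "\<lambda>(wz :: (real \<times> (real ^ 'n)) ^ 's) k. monomials e (snd (wz $ k))"
  have "i \<noteq> j"
    using ij by auto
  then have "card (UNIV - {i, j}) = CARD('s) - 2"
    by (simp add: card_Diff_subset)
  \<comment> \<open>Kernel conditions are imposed at all points but \<open>i\<close> and
    \<open>j\<close>, which are \<open>CARD('s) - 2\<close> in number.\<close>
  with count obtain q where q: "q \<noteq> 0" "q \<in> sym_matrices"
    and ker: "\<And>k. k \<in> UNIV - {i, j} \<Longrightarrow> q *v ?v wz0 k = 0"
    and van: "\<And>Y. Y \<in> moment_matrices e \<Longrightarrow> q \<bullet> Y = 0"
    using exists_vanishing_quadric[of "UNIV - {i, j}" e "?v wz0"] by auto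
  obtain x y where xy: "monomials e x \<bullet> (q *v monomials e y) \<noteq> 0"
    using exists_monomials_bilinear_nonzero[OF e q(1)] .
  \<comment> \<open>Only the points \<open>i\<close> and \<open>j\<close> move, to a pair on which
    \<open>q\<close> is nonzero as a bilinear form; along the whole line from \<open>wz0\<close> to
    \<open>wz1\<close> the kernel conditions at the other points persist.\<close>
  define wz1 :: "(real \<times> (real ^ 'n)) ^ 's"
    where "wz1 = (\<chi> k. if k = i then (0, x) else if k = j then (0, y) else wz0 $ k)"
  have Q1: "?v wz1 i \<bullet> (q *v ?v wz1 j) \<noteq> 0"
    using xy ij by (auto simp: wz1_def)
  have Q: "real_polynomial_function (\<lambda>wz. ?v wz i \<bullet> (q *v ?v wz j))"
    unfolding inner_vec_def matrix_vector_mult_def vec_lambda_beta inner_real_def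
    by (intro real_polynomial_function_sum real_polynomial_function.intros(4) finite
        real_polynomial_function_monomials real_polynomial_function.intros(2))
  obtain t where t: "det (gram_matrix S (pair_defect e (wz0 + t *\<^sub>R (wz1 - wz0)))) \<noteq> 0"
    "?v (wz0 + t *\<^sub>R (wz1 - wz0)) i \<bullet> (q *v ?v (wz0 + t *\<^sub>R (wz1 - wz0)) j) \<noteq> 0"
    using real_polynomial_functions_nonzero_on_line[OF
        real_polynomial_function_det_pair_defect Q G0 Q1] .
  define wz where "wz = wz0 + t *\<^sub>R (wz1 - wz0)"
  have ker': "q *v ?v wz k = 0" if "k \<noteq> i" "k \<noteq> j" for k
    using ker[of k] that by (simp add: wz_def wz1_def)
  have indep: "indexed_independent S (pair_defect e wz)"
    using t(1) by (simp add: det_gram_matrix_nonzero_iff wz_def)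
  have "indexed_independent (insert p S) (pair_defect e wz)"
    unfolding indexed_independent_def
  proof (intro allI impI)
    fix c
    let ?A = "\<lambda>p. sym_outer (?v wz (fst p)) (?v wz (snd p))"
    assume c: "(\<Sum>p\<in>insert p S. c p *\<^sub>R pair_defect e wz p) = 0"
    then have "(\<Sum>p\<in>insert p S. c p *\<^sub>R ?A p) \<in> moment_matrices e"
      unfolding pair_defect_def hankel_defect_sum hankel_defect_eq_0_iff .
    \<comment> \<open>Pairing the relation with \<open>q\<close> isolates the coefficient of
      \<open>p\<close>; the remaining relation falls to the independence on \<open>S\<close>, which
      the choice of \<open>t\<close> preserves.\<close>
    from van[OF this] have "(\<Sum>p\<in>insert p S. c p * (q \<bullet> ?A p)) = 0"
      by (simp add: inner_sum_right)
    moreover have "q \<bullet> ?A r = 0" if "r \<in> S" for r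
    proof -
      have "r \<noteq> p" "h (fst r) < h (snd r)"
        using that insert.hyps insert.prems by auto
      \<comment> \<open>\<open>h\<close> lists each unordered pair once, so a pair other than
        \<open>p\<close> contains an index different from \<open>i\<close> and \<open>j\<close>, and
        \<open>q\<close> kills the vector there.\<close>
      then have "(fst r \<noteq> i \<and> fst r \<noteq> j) \<or> (snd r \<noteq> i \<and> snd r \<noteq> j)"
        using ij p by (cases r) auto
      then have "q *v ?v wz (fst r) = 0 \<or> q *v ?v wz (snd r) = 0"
        using ker' by blast
      then show ?thesis
        using inner_symmetric_matrix[OF q(2), of "?v wz (fst r)" "?v wz (snd r)"]
        by (auto simp: inner_sym_outer[OF q(2)])
    qed
    ultimately have "c p * (q \<bullet> ?A p) = 0"
      using insert.hyps by simp
    then have "c p = 0"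
      using t(2) by (simp add: p inner_sym_outer[OF q(2)] wz_def)
    moreover from this have "(\<Sum>p\<in>S. c p *\<^sub>R pair_defect e wz p) = 0"
      using c insert.hyps by simp
    then have "\<forall>p\<in>S. c p = 0"
      using indep unfolding indexed_independent_def by blast
    ultimately show "\<forall>p\<in>insert p S. c p = 0"
      by simp
  qed
  then show ?case
    by blast
qed

section \<open>Simplicial faces\<close>

text \<open>Coefficients are functions on all indices that vanish off \<open>A\<close>, so the cone
  and its faces share one system of coordinates.\<close>

definition ray_cone :: "('s::finite \<Rightarrow> 'b::real_vector) \<Rightarrow> 's set \<Rightarrow> 'b set" where
  "ray_cone N A = {\<Sum>i\<in>UNIV. c i *\<^sub>R N i | c. (\<forall>i. 0 \<le> c i) \<and> (\<forall>i. i \<notin> A \<longrightarrow> c i = 0)}"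

lemma convex_ray_cone: "convex (ray_cone N A)"
  unfolding convex_def
proof (intro ballI allI impI)
  fix x y and u v :: real
  assume "x \<in> ray_cone N A" "y \<in> ray_cone N A" and uv: "0 \<le> u" "0 \<le> v" "u + v = 1"
  then obtain c c' where
    c: "x = (\<Sum>i\<in>UNIV. c i *\<^sub>R N i)" "\<And>i. 0 \<le> c i" "\<And>i. i \<notin> A \<Longrightarrow> c i = 0" and
    c': "y = (\<Sum>i\<in>UNIV. c' i *\<^sub>R N i)" "\<And>i. 0 \<le> c' i" "\<And>i. i \<notin> A \<Longrightarrow> c' i = 0"
    unfolding ray_cone_def by auto
  have "u *\<^sub>R x + v *\<^sub>R y = (\<Sum>i\<in>UNIV. (u * c i + v * c' i) *\<^sub>R N i)"
    by (simp add: c(1) c'(1) scaleR_sum_right sum.distrib scaleR_left_distrib)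
  moreover have "0 \<le> u * c i + v * c' i" for i
    using c(2) c'(2) uv by simp
  moreover have "u * c i + v * c' i = 0" if "i \<notin> A" for i
    using c(3) c'(3) that by simp
  ultimately show "u *\<^sub>R x + v *\<^sub>R y \<in> ray_cone N A"
    unfolding ray_cone_def by (intro CollectI exI[of _ "\<lambda>i. u * c i + v * c' i"]) simp
qed

lemma trace_mult_sum:
  fixes b :: "real ^ 'm ^ 'm"
  shows "trace (b ** (\<Sum>i\<in>I. c i *\<^sub>R N i)) = (\<Sum>i\<in>I. c i * trace (b ** N i))"
proof -
  have "linear (\<lambda>Z. trace (b ** Z))"
    by (rule linearI) (simp_all add: trace_def matrix_matrix_mult_def sum.distrib
        sum_distrib_left algebra_simps)
  from linear_sum[OF this, of "\<lambda>i. c i *\<^sub>R N i" I] linear_cmul[OF this] show ?thesis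
    by simp
qed

text \<open>Independence makes the coefficients unique; unit traces make the slice
  \<open>trace Z = 1\<close> of the cone a simplex with vertices \<open>N i\<close>.\<close>

locale simplicial_face =
  fixes C :: "(real ^ 'm ^ 'm) set" and N :: "'s::finite \<Rightarrow> real ^ 'm ^ 'm"
  assumes face: "ray_cone N UNIV face_of C"
    and indep: "(\<Sum>i\<in>UNIV. c i *\<^sub>R N i) = 0 \<Longrightarrow> c i = 0"
    and trace_N: "trace (N i) = 1"
begin

definition comb :: "('s \<Rightarrow> real) \<Rightarrow> real ^ 'm ^ 'm" where
  "comb c = (\<Sum>i\<in>UNIV. c i *\<^sub>R N i)"

lemma comb_diff: "comb c - comb c' = comb (\<lambda>i. c i - c' i)"
  and comb_add: "comb c + comb c' = comb (\<lambda>i. c i + c' i)"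
  and comb_scale: "r *\<^sub>R comb c = comb (\<lambda>i. r * c i)"
  by (simp_all add: comb_def sum_subtractf sum.distrib scaleR_sum_right algebra_simps)

lemma comb_eq_iff: "comb c = comb c' \<longleftrightarrow> c = c'"
proof
  assume "comb c = comb c'"
  then have "comb (\<lambda>i. c i - c' i) = 0"
    by (simp add: comb_diff[symmetric])
  then show "c = c'"
    using indep[of "\<lambda>i. c i - c' i"] by (simp add: comb_def fun_eq_iff)
qed simp

lemma comb_single: "comb (\<lambda>j. if j = i then t else 0) = t *\<^sub>R N i"
  by (simp add: comb_def if_distrib[of "\<lambda>x. x *\<^sub>R _"] cong: if_cong)

lemma comb_zero: "comb (\<lambda>_. 0) = 0"
  by (simp add: comb_def)

lemma comb_in_ray_cone:
  "comb c \<in> ray_cone N A \<longleftrightarrow> (\<forall>i. 0 \<le> c i) \<and> (\<forall>i. i \<notin> A \<longrightarrow> c i = 0)"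
proof -
  have "comb c \<in> ray_cone N A \<longleftrightarrow>
      (\<exists>c'. comb c = comb c' \<and> (\<forall>i. 0 \<le> c' i) \<and> (\<forall>i. i \<notin> A \<longrightarrow> c' i = 0))"
    unfolding ray_cone_def comb_def by simp
  then show ?thesis
    unfolding comb_eq_iff by simp
qed

lemma ray_coneD:
  assumes "Y \<in> ray_cone N A"
  shows "\<exists>c. Y = comb c \<and> (\<forall>i. 0 \<le> c i) \<and> (\<forall>i. i \<notin> A \<longrightarrow> c i = 0)"
  using assms unfolding ray_cone_def comb_def[symmetric] by simp

text \<open>Nonnegative coefficients cannot cancel: if a point inside a segment has coefficient zero
  at \<open>i\<close>, so have both endpoints. Transitivity of faces then passes from the full ray
  cone to \<open>C\<close>.\<close>

lemma ray_cone_face: "ray_cone N A face_of C"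
proof -
  have "ray_cone N A face_of ray_cone N UNIV"
    unfolding face_of_def
  proof (intro conjI ballI impI)
    show "ray_cone N A \<subseteq> ray_cone N UNIV"
      by (auto simp: ray_cone_def)
    show "convex (ray_cone N A)"
      by (rule convex_ray_cone)
    fix a b x
    assume a: "a \<in> ray_cone N UNIV" and b: "b \<in> ray_cone N UNIV" and x: "x \<in> ray_cone N A"
      and seg: "x \<in> open_segment a b"
    obtain \<alpha> where \<alpha>: "a = comb \<alpha>" "\<And>i. 0 \<le> \<alpha> i" "\<And>i. i \<notin> UNIV \<Longrightarrow> \<alpha> i = 0"
      using ray_coneD[OF a] by auto
    obtain \<beta> where \<beta>: "b = comb \<beta>" "\<And>i. 0 \<le> \<beta> i" "\<And>i. i \<notin> UNIV \<Longrightarrow> \<beta> i = 0"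
      using ray_coneD[OF b] by auto
    obtain \<xi> where \<xi>: "x = comb \<xi>" "\<And>i. 0 \<le> \<xi> i" "\<And>i. i \<notin> A \<Longrightarrow> \<xi> i = 0"
      using ray_coneD[OF x] by auto
    obtain u where u: "0 < u" "u < 1" "x = (1 - u) *\<^sub>R a + u *\<^sub>R b"
      using seg unfolding in_segment by blast
    have \<xi>_eq: "\<xi> = (\<lambda>i. (1 - u) * \<alpha> i + u * \<beta> i)"
      using u(3) unfolding \<alpha>(1) \<beta>(1) \<xi>(1) comb_scale comb_add comb_eq_iff .
    have "\<alpha> i = 0 \<and> \<beta> i = 0" if "i \<notin> A" for i
    proof -
      have "(1 - u) * \<alpha> i + u * \<beta> i = 0"
        using \<xi>(3)[OF that] by (simp add: \<xi>_eq)
      moreover have "0 \<le> (1 - u) * \<alpha> i" "0 \<le> u * \<beta> i"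
        using u \<alpha> \<beta> by simp_all
      ultimately show ?thesis
        using u by (simp add: add_nonneg_eq_0_iff)
    qed
    then show "a \<in> ray_cone N A" "b \<in> ray_cone N A"
      using \<alpha> \<beta> by (simp_all add: comb_in_ray_cone)
  qed
  then show ?thesis
    using face face_of_trans by blast
qed

text \<open>All coefficients of \<open>comb c\<close> on \<open>A\<close> are positive, so the
  segment from any other \<open>y\<close> in the cone can be prolonged beyond \<open>comb c\<close>;
  a face containing \<open>comb c\<close> then contains \<open>y\<close>.\<close>

lemma minface_comb:
  assumes pos: "\<And>i. i \<in> A \<Longrightarrow> 0 < c i" and zero: "\<And>i. i \<notin> A \<Longrightarrow> c i = 0"
  shows "minface (comb c) C = ray_cone N A"
proof
  have c0: "0 \<le> c i" for i
    using pos zero by (cases "i \<in> A") (auto intro: less_imp_le)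
  then have "comb c \<in> ray_cone N A"
    using zero by (simp add: comb_in_ray_cone)
  then show "minface (comb c) C \<subseteq> ray_cone N A"
    unfolding minface_def using ray_cone_face by blast
  show "ray_cone N A \<subseteq> minface (comb c) C"
  proof
    fix y
    assume "y \<in> ray_cone N A"
    from ray_coneD[OF this] obtain \<eta> where \<eta>: "y = comb \<eta>" "\<And>i. 0 \<le> \<eta> i" "\<And>i. i \<notin> A \<Longrightarrow> \<eta> i = 0"
      by auto
    have "y \<in> F" if F: "F face_of C" "comb c \<in> F" for F
    \<comment> \<open>Equal points span no open segment, and the minimum taken below needs a
      nonempty \<open>A\<close>.\<close>
    proof (cases "y = comb c \<or> A = {}")
      case True
      moreover have "\<eta> = c" if "A = {}"
        using zero \<eta>(3) that by (simp add: fun_eq_iff)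
      ultimately show ?thesis
        using F(2) \<eta>(1) by auto
    next
      case False
      define m where "m = Min (c ` A)"
      have m: "0 < m" "\<And>i. i \<in> A \<Longrightarrow> m \<le> c i"
        using False pos by (simp_all add: m_def)
      \<comment> \<open>\<open>T\<close> exceeds \<open>m\<close> and bounds every
        \<open>\<eta> i\<close>, so \<open>\<epsilon> = m / T\<close> is less than 1 and
        \<open>\<epsilon> * \<eta> i\<close> is at most \<open>c i\<close>.\<close>
      define T where "T = m + sum \<eta> UNIV + 1"
      have sum_\<eta>: "0 \<le> sum \<eta> UNIV" "\<And>i. \<eta> i \<le> sum \<eta> UNIV"
        using \<eta>(2) by (auto intro: sum_nonneg member_le_sum)
      define \<epsilon> where "\<epsilon> = m / T"
      have T: "0 < T" "m < T" "\<And>i. \<eta> i \<le> T"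
        using m(1) sum_\<eta> unfolding T_def by (auto intro: order_trans[OF sum_\<eta>(2)])
      have \<epsilon>: "0 < \<epsilon>" "\<epsilon> < 1"
        using T m by (simp_all add: \<epsilon>_def)
      have le: "\<epsilon> * \<eta> i \<le> c i" for i
      proof (cases "i \<in> A")
        case True
        have "\<epsilon> * \<eta> i \<le> \<epsilon> * T"
          using \<epsilon> T(3) by simp
        also have "\<dots> = m"
          using T by (simp add: \<epsilon>_def)
        finally show ?thesis
          using m(2)[OF True] by simp
      qed (simp add: \<eta> zero)
      \<comment> \<open>The point beyond \<open>comb c\<close> on the line from \<open>y\<close>,
        scaled so that \<open>comb c\<close> divides the segment from \<open>a\<close> to
        \<open>y\<close> at \<open>\<epsilon>\<close>.\<close>
      define a where "a = comb (\<lambda>i. (c i - \<epsilon> * \<eta> i) / (1 - \<epsilon>))"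
      have eq: "comb c = (1 - \<epsilon>) *\<^sub>R a + \<epsilon> *\<^sub>R y"
        using \<epsilon> by (simp add: a_def \<eta>(1) comb_scale comb_add)
      have "a \<in> ray_cone N UNIV" "y \<in> ray_cone N UNIV"
        using le \<epsilon> \<eta> by (simp_all add: a_def comb_in_ray_cone)
      then have "a \<in> C" "y \<in> C"
        using face_of_imp_subset[OF face] by auto
      moreover have "a \<noteq> y"
        using False eq by (auto simp: scaleR_left_diff_distrib)
      then have "comb c \<in> open_segment a y"
        using \<epsilon> eq unfolding in_segment by blast
      ultimately show ?thesis
        using face_ofD[OF F(1)] F(2) by blast
    qed
    then show "y \<in> minface (comb c) C"
      unfolding minface_def by blast
  qed
qed

text \<open>On the slice the coefficients are convex weights and the objective is the weighted mean
  of the vertex values. As these are distinct, the smallest one over \<open>A\<close> is attained at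
  its vertex alone.\<close>

lemma arg_min_ray_cone:
  assumes "A \<noteq> {}" and inj: "inj (\<lambda>i. trace (b ** N i))"
  obtains i where "i \<in> A"
    "\<And>M. is_arg_min (\<lambda>Z. trace (b ** Z)) (\<lambda>Z. Z \<in> ray_cone N A \<and> trace Z = 1) M \<longleftrightarrow> M = N i"
proof -
  let ?\<beta> = "\<lambda>i. trace (b ** N i)"
  let ?P = "\<lambda>Z. Z \<in> ray_cone N A \<and> trace Z = 1"
  have trace_comb: "trace (comb c) = sum c UNIV" for c
    using trace_mult_sum[of "mat 1" c N UNIV] by (simp add: comb_def trace_N)
  have trace_b: "trace (b ** comb c) = (\<Sum>i\<in>UNIV. c i * ?\<beta> i)" for c
    unfolding comb_def by (rule trace_mult_sum)
  define i where "i = arg_min_on ?\<beta> A"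
  have i: "i \<in> A" "\<And>j. j \<in> A \<Longrightarrow> ?\<beta> i \<le> ?\<beta> j"
    using arg_min_if_finite(1)[of A ?\<beta>] arg_min_least[of A _ ?\<beta>] assms(1)
    unfolding i_def by auto
  have N: "N j = comb (\<lambda>k. if k = j then 1 else 0)" for j
    by (simp add: comb_single)
  have Pi: "?P (N i)"
    using i(1) trace_N[of i] unfolding N[of i] comb_in_ray_cone by auto
  have less: "?\<beta> i < trace (b ** M)" if PM: "?P M" and neq: "M \<noteq> N i" for M
  proof -
    obtain c where c: "M = comb c" "\<And>i. 0 \<le> c i" "\<And>i. i \<notin> A \<Longrightarrow> c i = 0"
      using ray_coneD[of M A] PM by auto
    have sum1: "sum c UNIV = 1"
      using PM by (simp add: c(1) trace_comb)
    have "\<exists>j. j \<noteq> i \<and> c j \<noteq> 0"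
    proof (rule ccontr)
      assume "\<not> ?thesis"
      then have c_eq: "c = (\<lambda>j. if j = i then c i else 0)"
        by (auto simp: fun_eq_iff)
      have "sum c UNIV = c i"
        by (subst c_eq) simp
      with sum1 have "c i = 1"
        by simp
      with c_eq have "c = (\<lambda>j. if j = i then 1 else 0)"
        by metis
      then show False
        using neq by (simp add: c(1) N)
    qed
    then obtain j where j: "j \<noteq> i" "c j \<noteq> 0"
      by blast
    then have "j \<in> A" "0 < c j"
      using c(2)[of j] c(3)[of j] by auto
    have nonneg: "0 \<le> c k * (?\<beta> k - ?\<beta> i)" for k
      using c(2)[of k] c(3)[of k] i(2)[of k] by (cases "k \<in> A") auto
    have "?\<beta> i \<noteq> ?\<beta> j"
      using inj j(1) by (auto dest: injD)
    then have "0 < c j * (?\<beta> j - ?\<beta> i)"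
      using i(2)[OF \<open>j \<in> A\<close>] \<open>0 < c j\<close> by simp
    then have "0 < (\<Sum>k\<in>UNIV. c k * (?\<beta> k - ?\<beta> i))"
      using nonneg by (intro sum_pos2[of UNIV j]) auto
    also have "\<dots> = trace (b ** M) - ?\<beta> i"
      using sum1 by (simp add: c(1) trace_b right_diff_distrib sum_subtractf
          sum_distrib_right[symmetric])
    finally show ?thesis
      by simp
  qed
  show ?thesis
  proof (rule that[OF i(1)])
    show "is_arg_min (\<lambda>Z. trace (b ** Z)) ?P M \<longleftrightarrow> M = N i" for M
      unfolding is_arg_min_def using Pi less by (metis less_asym less_irrefl)
  qed
qed

text \<open>Subtracting \<open>t *\<^sub>R N i\<close> lowers coefficient \<open>i\<close> only, so
  the admissible \<open>t\<close> form the interval from \<open>0\<close> to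
  \<open>c i\<close>.\<close>

lemma Sup_step:
  assumes "i \<in> A" and pos: "\<And>i. i \<in> A \<Longrightarrow> 0 < c i" and zero: "\<And>i. i \<notin> A \<Longrightarrow> c i = 0"
  shows "Sup {t. 0 \<le> t \<and> comb c - t *\<^sub>R N i \<in> ray_cone N A} = c i"
proof -
  have c0: "0 \<le> c i" for i
    using pos zero by (cases "i \<in> A") (auto intro: less_imp_le)
  have "comb c - t *\<^sub>R N i \<in> ray_cone N A \<longleftrightarrow> t \<le> c i" for t
  proof -
    have "(\<forall>j. 0 \<le> c j - (if j = i then t else 0)) \<longleftrightarrow> t \<le> c i"
      using c0 by (metis diff_ge_0_iff_ge diff_zero)
    moreover have "\<forall>j. j \<notin> A \<longrightarrow> c j - (if j = i then t else 0) = 0"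
      using \<open>i \<in> A\<close> zero by auto
    ultimately show ?thesis
      unfolding comb_single[symmetric] comb_diff comb_in_ray_cone by blast
  qed
  then have "{t. 0 \<le> t \<and> comb c - t *\<^sub>R N i \<in> ray_cone N A} = {0..c i}"
    unfolding atLeastAtMost_def atLeast_def atMost_def by simp blast
  then show ?thesis
    using c0 by simp
qed

section \<open>The run of the algorithm on a simplicial face\<close>

context
  fixes c :: "'s \<Rightarrow> real" and B :: "nat \<Rightarrow> real ^ 'm ^ 'm"
  assumes c_pos: "0 < c i"
    and inj_B: "1 \<le> k \<Longrightarrow> inj (\<lambda>i. trace (B k ** N i))"
begin

text \<open>\<open>l\<close> records the order in which rays have been removed. A removal erases the
  whole coefficient of its ray, so \<open>l\<close> determines the state.\<close>

definition state :: "'s list \<Rightarrow> (real \<times> (real ^ 'm ^ 'm)) list \<times> (real ^ 'm ^ 'm)" where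
  "state l = (map (\<lambda>i. (c i, N i)) l, comb (\<lambda>i. if i \<in> set l then 0 else c i))"

lemma snd_state_eq_0_iff: "snd (state l) = 0 \<longleftrightarrow> set l = UNIV"
proof -
  have "c i \<noteq> 0" for i
    using c_pos[of i] by simp
  then show ?thesis
    unfolding state_def snd_conv comb_zero[symmetric] comb_eq_iff by (auto simp: fun_eq_iff)
qed

text \<open>The minimal face is spanned by the rays outside \<open>l\<close>, and then both the
  minimiser and the step length are forced. The output list is as long as \<open>l\<close>, so the
  matrix in use is \<open>B (Suc (length l))\<close>.\<close>

lemma erd_step_state:
  assumes "set l \<noteq> UNIV"
  obtains i where "i \<notin> set l" "\<And>s. erd_step C B (state l) s \<longleftrightarrow> s = state (l @ [i])"
proof -
  let ?c = "\<lambda>i. if i \<in> set l then 0 else c i"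
  have c': "0 < ?c i" if "i \<in> - set l" for i
    using that c_pos by simp
  have c'': "?c i = 0" if "i \<notin> - set l" for i
    using that by simp
  have F: "minface (comb ?c) C = ray_cone N (- set l)"
    by (rule minface_comb[OF c' c''])
  obtain i where i: "i \<in> - set l"
    "\<And>M. is_arg_min (\<lambda>Z. trace (B (Suc (length l)) ** Z))
        (\<lambda>Z. Z \<in> ray_cone N (- set l) \<and> trace Z = 1) M \<longleftrightarrow> M = N i"
    using arg_min_ray_cone[of "- set l" "B (Suc (length l))"] inj_B[of "Suc (length l)"] assms
    by auto
  have Sup: "Sup {t. 0 \<le> t \<and> comb ?c - t *\<^sub>R N i \<in> ray_cone N (- set l)} = c i"
    using Sup_step[OF i(1) c' c''] i(1) by simp
  have Y: "comb ?c \<noteq> 0"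
    using snd_state_eq_0_iff[of l] assms by (simp add: state_def)
  have next_Y: "comb ?c - c i *\<^sub>R N i = comb (\<lambda>j. if j \<in> set (l @ [i]) then 0 else c j)"
    unfolding comb_single[symmetric] comb_diff comb_eq_iff
    using i(1) by (auto simp: fun_eq_iff)
  show ?thesis
  proof (rule that)
    show "i \<notin> set l"
      using i(1) by simp
    show "erd_step C B (state l) s \<longleftrightarrow> s = state (l @ [i])" for s
    proof
      assume "erd_step C B (state l) s"
      then have "erd_step C B (map (\<lambda>i. (c i, N i)) l, comb ?c) s"
        by (simp add: state_def)
      then show "s = state (l @ [i])"
      proof (cases rule: erd_step.cases)
        case (1 F' M t)
        have "M = N i"
          using 1(4) i(2) unfolding 1(3) F length_map by simp
        moreover from this have "t = c i"
          using 1(5) Sup unfolding 1(3) F by simp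
        ultimately show ?thesis
          using 1(1) next_Y by (simp add: state_def)
      qed
    next
      assume s: "s = state (l @ [i])"
      have "erd_step C B (map (\<lambda>i. (c i, N i)) l, comb ?c)
          (map (\<lambda>i. (c i, N i)) l @ [(c i, N i)], comb ?c - c i *\<^sub>R N i)"
        by (rule erd_step.intros[OF Y refl]) (simp_all add: F i(2) Sup)
      then show "erd_step C B (state l) s"
        unfolding s next_Y by (simp add: state_def)
    qed
  qed
qed

lemma erd_reachable:
  assumes "(erd_step C B)\<^sup>*\<^sup>* (state []) s"
  shows "\<exists>l. distinct l \<and> s = state l"
  using assms
proof (induction rule: rtranclp_induct)
  case base
  then show ?case
    by (metis distinct.simps(1))
next
  case (step y z)
  then obtain l where l: "distinct l" "y = state l"
    by blast
  have "snd y \<noteq> 0"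
    using step.hyps(2) by (auto elim: erd_step.cases)
  then have "set l \<noteq> UNIV"
    using snd_state_eq_0_iff l(2) by blast
  then obtain i where "i \<notin> set l" "\<And>s. erd_step C B (state l) s \<longleftrightarrow> s = state (l @ [i])"
    using erd_step_state by metis
  then show ?case
    using l step.hyps(2) by (intro exI[of _ "l @ [i]"]) auto
qed

text \<open>Every step appends a new index, so the number of indices still missing from
  \<open>l\<close> decreases.\<close>

lemma termip_state:
  assumes "distinct l"
  shows "termip (erd_step C B) (state l)"
  using assms
proof (induction "CARD('s) - length l" arbitrary: l rule: less_induct)
  case less
  show ?case
  proof (rule accpI)
    fix s
    assume "(erd_step C B)\<inverse>\<inverse> s (state l)"
    then have step: "erd_step C B (state l) s"
      by simp
    then have "set l \<noteq> UNIV"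
      using snd_state_eq_0_iff[of l] by (auto elim: erd_step.cases)
    then obtain i where i: "i \<notin> set l" "\<And>s. erd_step C B (state l) s \<longleftrightarrow> s = state (l @ [i])"
      using erd_step_state by metis
    have "distinct (l @ [i])"
      using less.prems i(1) by simp
    moreover from this have "length (l @ [i]) \<le> CARD('s)"
      by (metis distinct_card card_mono finite_class.finite_UNIV subset_UNIV)
    ultimately have "termip (erd_step C B) (state (l @ [i]))"
      by (intro less.hyps) auto
    then show "termip (erd_step C B) s"
      using step i(2) by simp
  qed
qed

lemma state_Nil: "state [] = ([], comb c)"
  by (simp add: state_def)

lemma erd_terminates_comb: "erd_terminates C B (comb c)"
proof -
  have "Ex (erd_step C B (ts, Y))" 
    if reach: "(erd_step C B)\<^sup>*\<^sup>* (state []) (ts, Y)" and "Y \<noteq> 0" for ts Y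
  proof -
    obtain l where l: "(ts, Y) = state l"
      using erd_reachable[OF reach] by blast
    then have "set l \<noteq> UNIV"
      using snd_state_eq_0_iff[of l] \<open>Y \<noteq> 0\<close> by (metis snd_conv)
    then obtain i where "erd_step C B (state l) (state (l @ [i]))"
      using erd_step_state by metis
    then show ?thesis
      unfolding l by (rule exI)
  qed
  then show ?thesis
    using termip_state[of "[]"] unfolding erd_terminates_def state_Nil by simp
qed

lemma erd_returns_comb:
  assumes "erd_returns C B (comb c) ts"
  obtains l where "distinct l" "set l = UNIV" "ts = map (\<lambda>i. (c i, N i)) l"
proof -
  obtain l where l: "distinct l" "(ts, 0) = state l"
    using erd_reachable[of "(ts, 0)"] assms unfolding erd_returns_def state_Nil by blast
  then have "set l = UNIV"
    using snd_state_eq_0_iff[of l] by (metis snd_conv)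
  then show ?thesis
    using that l by (simp add: state_def)
qed

end

end

section \<open>Random linear functionals\<close>

text \<open>Fubini: \<open>D\<close> has a nonzero entry at \<open>(a0, b0)\<close>, so the
  functional is affine and nonconstant in the coordinate \<open>{a0, b0}\<close>, and each line in
  that direction meets the hyperplane in a single point.\<close>

lemma null_sets_sym_lebesgue_hyperplane:
  fixes D :: "real ^ 'm::finite ^ 'm"
  assumes D: "D \<in> sym_matrices" "D \<noteq> 0"
  shows "{S. trace (S ** D) = 0} \<in> null_sets sym_lebesgue"
proof -
  interpret product_sigma_finite "\<lambda>_ :: 'm set. lborel :: real measure"
    by standard
  let ?I = "sym_coords :: 'm set set"
  let ?H = "{S :: real ^ 'm ^ 'm. trace (S ** D) = 0}"
  have sym: "D $ a $ b = D $ b $ a" for a b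
    using D(1) by (auto simp: sym_matrices_def transpose_def vec_eq_iff)
  have "continuous_on UNIV (\<lambda>S. trace (S ** D))"
    unfolding trace_def matrix_matrix_mult_def by (simp, intro continuous_intros)
  then have "closed ?H"
    by (intro closed_Collect_eq continuous_on_const)
  then have H [measurable]: "?H \<in> sets borel"
    by simp
  obtain a0 b0 where ab0: "D $ a0 $ b0 \<noteq> 0"
    using D(2) by (metis vec_eq_iff zero_index)
  let ?c = "{a0, b0}"
  define g where "g x = trace (sym_of_coords x ** D)" for x
  have g: "g x = (\<Sum>a\<in>UNIV. \<Sum>b\<in>UNIV. x {a, b} * D $ b $ a)" for x
    by (simp add: g_def trace_def matrix_matrix_mult_def sym_of_coords_def)
  \<comment> \<open>The slope of \<open>g\<close> in the coordinate \<open>?c\<close>: the entry of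
    \<open>D\<close> counted once on the diagonal and twice off it.\<close>
  define \<kappa> where "\<kappa> = (\<Sum>a\<in>UNIV. \<Sum>b\<in>UNIV. if {a, b} = ?c then D $ b $ a else 0)"
  have "\<kappa> = (\<Sum>p\<in>UNIV. if {fst p, snd p} = ?c then D $ snd p $ fst p else 0)"
    unfolding \<kappa>_def by (simp add: sum.cartesian_product case_prod_beta)
  also have "\<dots> = (\<Sum>p\<in>{(a0, b0), (b0, a0)}. D $ a0 $ b0)"
    by (rule sum.mono_neutral_cong_right) (auto simp: doubleton_eq_iff sym split: if_splits)
  finally have \<kappa>: "\<kappa> \<noteq> 0"
    using ab0 by (cases "a0 = b0") auto
  have g_upd: "g (x(?c := y)) = g (x(?c := 0)) + y * \<kappa>" for x y
    unfolding g \<kappa>_def sum_distrib_left sum.distrib[symmetric]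
    by (intro sum.cong refl) auto
  have I: "insert ?c (?I - {?c}) = ?I"
    by (auto simp: sym_coords_def)
  have meas: "(\<lambda>x. indicator ?H (sym_of_coords x) :: ennreal) \<in>
      borel_measurable (\<Pi>\<^sub>M c\<in>insert ?c (?I - {?c}). lborel)"
    unfolding I by measurable
  have "emeasure sym_lebesgue ?H = (\<integral>\<^sup>+ S. indicator ?H S \<partial>sym_lebesgue)"
    by (simp add: sym_lebesgue_def)
  also have "\<dots> = (\<integral>\<^sup>+ x. indicator ?H (sym_of_coords x) \<partial>(\<Pi>\<^sub>M c\<in>?I. lborel))"
    unfolding sym_lebesgue_def by (rule nn_integral_distr) simp_all
  also have "\<dots> = (\<integral>\<^sup>+ x. indicator ?H (sym_of_coords x) \<partial>(\<Pi>\<^sub>M c\<in>insert ?c (?I - {?c}). lborel))"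
    unfolding I ..
  also have "(\<integral>\<^sup>+ x. indicator ?H (sym_of_coords x) \<partial>(\<Pi>\<^sub>M c\<in>insert ?c (?I - {?c}). lborel)) =
    (\<integral>\<^sup>+ x. (\<integral>\<^sup>+ y. indicator ?H (sym_of_coords (x(?c := y))) \<partial>lborel)
      \<partial>(\<Pi>\<^sub>M c\<in>?I - {?c}. lborel))"
    by (rule product_nn_integral_insert[OF _ _ meas]) simp_all
  also have "\<dots> = (\<integral>\<^sup>+ x. 0 \<partial>(\<Pi>\<^sub>M c\<in>?I - {?c}. (lborel :: real measure)))"
  proof (intro nn_integral_cong)
    fix x
    have "indicator ?H (sym_of_coords (x(?c := y))) =
        (indicator {- g (x(?c := 0)) / \<kappa>} y :: ennreal)" for y
    proof -
      have "sym_of_coords (x(?c := y)) \<in> ?H \<longleftrightarrow> g (x(?c := 0)) + y * \<kappa> = 0"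
        using g_upd[of x y] by (simp add: g_def)
      also have "\<dots> \<longleftrightarrow> y = - g (x(?c := 0)) / \<kappa>"
        using \<kappa> by (auto simp: field_simps eq_neg_iff_add_eq_0)
      finally show ?thesis
        by (simp add: indicator_def)
    qed
    then show "(\<integral>\<^sup>+ y. indicator ?H (sym_of_coords (x(?c := y))) \<partial>lborel) = 0"
      by simp
  qed
  finally have "emeasure sym_lebesgue ?H = 0"
    by simp
  then show ?thesis
    using H by (intro null_setsI) (simp_all add: sym_lebesgue_def)
qed

text \<open>Two rays receive equal values only if the draw lies in the hyperplane orthogonal to
  \<open>N i - N j\<close>. There are finitely many such hyperplanes, each a null set by absolute
  continuity.\<close>

lemma AE_inj_trace:
  fixes P :: "'w measure" and B :: "'w \<Rightarrow> real ^ 'm ^ 'm" and N :: "'s::finite \<Rightarrow> real ^ 'm ^ 'm"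
  assumes B: "B \<in> P \<rightarrow>\<^sub>M borel"
    and ac: "absolutely_continuous sym_lebesgue (distr P borel B)"
    and N: "\<And>i. N i \<in> sym_matrices" "inj N"
  shows "AE \<omega> in P. inj (\<lambda>i. trace (B \<omega> ** N i))"
proof -
  have "AE \<omega> in P. i \<noteq> j \<longrightarrow> trace (B \<omega> ** N i) \<noteq> trace (B \<omega> ** N j)" for i j
  proof (cases "i = j")
    case False
    have "N i - N j \<in> sym_matrices" "N i - N j \<noteq> 0"
      using N False by (auto simp: sym_matrices_def transpose_def vec_eq_iff dest: injD)
    then have "{S. trace (S ** (N i - N j)) = 0} \<in> null_sets (distr P borel B)"
      using null_sets_sym_lebesgue_hyperplane ac unfolding absolutely_continuous_def by blast
    then have "AE S in distr P borel B. S \<notin> {S. trace (S ** (N i - N j)) = 0}"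
      by (rule AE_not_in)
    then have "AE \<omega> in P. B \<omega> \<notin> {S. trace (S ** (N i - N j)) = 0}"
      by (rule AE_distrD[OF B])
    then show ?thesis
      by (rule AE_mp) (auto simp: trace_def matrix_matrix_mult_def right_diff_distrib sum_subtractf)
  qed simp
  then have "AE \<omega> in P. \<forall>i j. i \<noteq> j \<longrightarrow> trace (B \<omega> ** N i) \<noteq> trace (B \<omega> ** N j)"
    by (simp add: AE_all_countable)
  then show ?thesis
    by (rule AE_mp) (auto intro!: AE_I2 injI)
qed

section \<open>The minimal face of a generic moment matrix\<close>

lemma sum_pairs_split:
  fixes f :: "'s::finite \<Rightarrow> 's \<Rightarrow> 'a::comm_monoid_add" and h :: "'s \<Rightarrow> nat"
  assumes "inj h"
  shows "(\<Sum>i\<in>UNIV. \<Sum>j\<in>UNIV. f i j) = (\<Sum>i\<in>UNIV. f i i) +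
    (\<Sum>p\<in>{(i, j). h i < h j}. f (fst p) (snd p) + f (snd p) (fst p))"
proof -
  let ?D = "range (\<lambda>i. (i, i))" and ?P = "{(i, j). h i < h j}"
  let ?P' = "prod.swap ` ?P" and ?f = "\<lambda>p. f (fst p) (snd p)"
  have univ: "UNIV = ?D \<union> (?P \<union> ?P')"
  proof (rule UNIV_eq_I)
    have mem: "(i, j) \<in> ?D \<union> (?P \<union> ?P')" for i j
    proof (cases "h i" "h j" rule: linorder_cases)
      case equal
      then show ?thesis
        using assms by (auto dest: injD)
    qed (force simp: image_iff)+
    show "p \<in> ?D \<union> (?P \<union> ?P')" for p
      using mem[of "fst p" "snd p"] by (simp only: prod.collapse)
  qed
  have "(\<Sum>i\<in>UNIV. \<Sum>j\<in>UNIV. f i j) = sum ?f UNIV"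
    by (simp add: sum.cartesian_product case_prod_beta)
  also have "\<dots> = sum ?f ?D + sum ?f (?P \<union> ?P')"
    by (subst univ, rule sum.union_disjoint) auto
  also have "sum ?f (?P \<union> ?P') = sum ?f ?P + sum ?f ?P'"
    by (rule sum.union_disjoint) auto
  also have "sum ?f ?D = (\<Sum>i\<in>UNIV. f i i)"
    by (subst sum.reindex) (auto intro: inj_onI)
  also have "sum ?f ?P' = (\<Sum>p\<in>?P. f (snd p) (fst p))"
    by (subst sum.reindex) (auto intro: inj_onI)
  finally show ?thesis
    by (simp add: sum.distrib)
qed

definition rank_one_comb ::
    "('s::finite \<Rightarrow> real ^ 'm) \<Rightarrow> ('s \<Rightarrow> 's \<Rightarrow> real) \<Rightarrow> real ^ 'm ^ 'm" where
  "rank_one_comb v Z = (\<Sum>i\<in>UNIV. \<Sum>j\<in>UNIV. Z i j *\<^sub>R rank_one (v i) (v j))"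

text \<open>The diagonal of \<open>Z\<close> stays free because the matrices
  \<open>outer (v i)\<close> will be moment matrices themselves.\<close>

definition products_independent ::
    "('m::finite \<Rightarrow> 'k \<Rightarrow> nat) \<Rightarrow> ('s::finite \<Rightarrow> real ^ 'm) \<Rightarrow> bool" where
  "products_independent e v \<longleftrightarrow> (\<forall>Z. (\<forall>i j. Z i j = Z j i) \<longrightarrow>
     rank_one_comb v Z \<in> moment_matrices e \<longrightarrow> (\<forall>i j. i \<noteq> j \<longrightarrow> Z i j = 0))"

lemma products_independentD:
  assumes "products_independent e v" "\<And>i j. Z i j = Z j i"
    and "rank_one_comb v Z \<in> moment_matrices e" "i \<noteq> j"
  shows "Z i j = 0"
  using assms unfolding products_independent_def by blast

text \<open>Subtracting the diagonal part, which is a moment matrix, leaves a combination of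
  symmetrised products that \<open>hankel_defect\<close> maps to zero.\<close>

lemma products_independentI:
  fixes h :: "'s::finite \<Rightarrow> nat" and v :: "'s \<Rightarrow> real ^ 'm"
  assumes h: "inj h"
    and indep: "indexed_independent {(i, j). h i < h j}
      (\<lambda>p. hankel_defect e (sym_outer (v (fst p)) (v (snd p))))"
    and v: "\<And>i. outer (v i) \<in> moment_matrices e"
  shows "products_independent e v"
  unfolding products_independent_def
proof (intro allI impI)
  fix Z i j
  assume Z: "\<forall>i j. Z i j = Z j i" and mem: "rank_one_comb v Z \<in> moment_matrices e"
    and "i \<noteq> (j :: 's)"
  let ?P = "{(i, j). h i < h j}" and ?A = "\<lambda>p. sym_outer (v (fst p)) (v (snd p))"
  have "rank_one_comb v Z = (\<Sum>i\<in>UNIV. Z i i *\<^sub>R outer (v i)) +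
      (\<Sum>p\<in>?P. Z (fst p) (snd p) *\<^sub>R ?A p)"
    unfolding rank_one_comb_def sum_pairs_split[OF h] sym_outer_def outer_eq_rank_one
      scaleR_right_distrib by (simp add: Z[rule_format, of "snd _"])
  moreover have "(\<Sum>i\<in>UNIV. Z i i *\<^sub>R outer (v i)) \<in> moment_matrices e"
    by (intro subspace_sum subspace_scale subspace_moment_matrices v)
  ultimately have "(\<Sum>p\<in>?P. Z (fst p) (snd p) *\<^sub>R ?A p) \<in> moment_matrices e"
    using subspace_diff[OF subspace_moment_matrices mem, of "\<Sum>i\<in>UNIV. Z i i *\<^sub>R outer (v i)"]
    by simp
  then have "(\<Sum>p\<in>?P. Z (fst p) (snd p) *\<^sub>R hankel_defect e (?A p)) = 0"
    by (simp add: hankel_defect_sum hankel_defect_eq_0_iff)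
  then have P: "Z (fst p) (snd p) = 0" if "p \<in> ?P" for p
    using indep that unfolding indexed_independent_def
    by (elim allE[of _ "\<lambda>p. Z (fst p) (snd p)"]) blast
  have "h i \<noteq> h j"
    using h \<open>i \<noteq> j\<close> by (auto dest: injD)
  then show "Z i j = 0"
    using P[of "(i, j)"] P[of "(j, i)"] Z[rule_format, of i j] by (cases "h i < h j") auto
qed

text \<open>A relation \<open>\<Sum>\<^sub>l a\<^sub>l v\<^sub>l = 0\<close> multiplied by \<open>v\<^sub>j\<close> is a relation between the symmetric
  products, so only a single vector can escape.\<close>

lemma products_independent_imp_independent:
  fixes v :: "'s::finite \<Rightarrow> real ^ 'm"
  assumes offdiag: "products_independent e v"
    and nz: "\<And>i. v i \<noteq> 0"
    and a: "(\<Sum>i\<in>UNIV. a i *\<^sub>R v i) = 0"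
  shows "a i = 0"
proof (cases "\<exists>j. j \<noteq> i")
  case True
  then obtain j where "i \<noteq> j"
    by metis
  \<comment> \<open>The coefficients of the relation multiplied by \<open>v j\<close> from both
    sides; for \<open>i \<noteq> j\<close> the entry \<open>Z i j\<close> is
    \<open>a i\<close>.\<close>
  define Z where "Z k l = (if k = j then a l else 0) + (if l = j then a k else 0)" for k l
  have rank_one_comb_eq: "rank_one_comb v Z = rank_one (v j) (\<Sum>l\<in>UNIV. a l *\<^sub>R v l) +
      rank_one (\<Sum>k\<in>UNIV. a k *\<^sub>R v k) (v j)"
  proof -
    have "rank_one_comb v Z = (\<Sum>k\<in>UNIV. \<Sum>l\<in>UNIV. (if k = j then a l *\<^sub>R rank_one (v k) (v l) else 0)) +
        (\<Sum>k\<in>UNIV. \<Sum>l\<in>UNIV. (if l = j then a k *\<^sub>R rank_one (v k) (v l) else 0))"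
      unfolding rank_one_comb_def Z_def sum.distrib[symmetric]
      by (intro sum.cong refl) (auto simp: scaleR_left_distrib)
    also have "(\<Sum>k\<in>UNIV. \<Sum>l\<in>UNIV. (if k = j then a l *\<^sub>R rank_one (v k) (v l) else 0)) =
        (\<Sum>k\<in>UNIV. if k = j then \<Sum>l\<in>UNIV. a l *\<^sub>R rank_one (v k) (v l) else 0)"
      by (intro sum.cong refl) auto
    finally show ?thesis
      by (simp add: rank_one_def vec_eq_iff sum_distrib_left sum_distrib_right mult_ac)
  qed
  then have "rank_one_comb v Z \<in> moment_matrices e"
    unfolding a by (simp add: rank_one_def moment_matrices_iff)
  moreover have "Z k l = Z l k" for k l
    by (simp add: Z_def)
  ultimately have "Z i j = 0"
    using \<open>i \<noteq> j\<close> products_independentD[OF offdiag] by blast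
  then show ?thesis
    using \<open>i \<noteq> j\<close> by (simp add: Z_def)
next
  case False
  then have "(UNIV :: 's set) = {i}"
    by auto
  then have "a i *\<^sub>R v i = 0"
    using a by (metis (no_types, lifting) finite.intros(1) empty_iff sum.empty sum.insert add.right_neutral)
  then show ?thesis
    using nz by simp
qed

section \<open>Positive semidefinite matrices supported on the span of a family\<close>

lemma exists_dual_family:
  fixes v :: "'s::finite \<Rightarrow> real ^ 'm"
  assumes "\<And>a i. (\<Sum>i\<in>UNIV. a i *\<^sub>R v i) = 0 \<Longrightarrow> a i = 0"
  obtains u where "\<And>i j. u i \<bullet> v j = (if i = j then 1 else 0)"
proof -
  \<comment> \<open>The dual vectors are the rows of a left inverse of the matrix with columns
    \<open>v i\<close>.\<close>
  define V :: "real ^ 's ^ 'm" where "V = (\<chi> a i. v i $ a)"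
  have V: "V *v x = (\<Sum>i\<in>UNIV. x $ i *\<^sub>R v i)" for x
    by (simp add: V_def vec_eq_iff matrix_vector_mult_def mult.commute)
  have "x = 0" if "V *v x = 0" for x
    using assms[of "\<lambda>i. x $ i"] that by (simp add: V vec_eq_iff)
  then obtain B where B: "B ** V = mat 1"
    using matrix_left_invertible_ker by blast
  have "B $ i \<bullet> v j = (if i = j then 1 else 0)" for i j
    using arg_cong[OF B, of "\<lambda>A. A $ i $ j"]
    by (simp add: matrix_matrix_mult_def inner_vec_def V_def mat_def)
  then show ?thesis
    using that by blast
qed

text \<open>If \<open>A *v x\<close> were nonzero, a small move from \<open>x\<close> against it
  would make the quadratic form negative, since the linear term beats the quadratic one.\<close>

lemma psd_quadratic_form_eq_0:
  assumes A: "A \<in> psd_matrices" and x: "x \<bullet> (A *v x) = 0"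
  shows "A *v x = 0"
proof (rule ccontr)
  let ?y = "A *v x"
  assume "?y \<noteq> 0"
  then have y: "0 < ?y \<bullet> ?y"
    by simp
  have sym: "A \<in> sym_matrices" and psd: "\<And>x. 0 \<le> x \<bullet> (A *v x)"
    using A by (auto simp: psd_matrices_def)
  let ?K = "?y \<bullet> (A *v ?y)"
  \<comment> \<open>Adding 1 avoids division by zero and still keeps \<open>t * ?K\<close> at most
    \<open>?y \<bullet> ?y\<close>, short of the twofold value that semidefiniteness would
    demand.\<close>
  define t where "t = (?y \<bullet> ?y) / (?K + 1)"
  have K: "0 \<le> ?K"
    by (rule psd)
  have t: "0 < t"
    using y K by (simp add: t_def)
  have "(x - t *\<^sub>R ?y) \<bullet> (A *v (x - t *\<^sub>R ?y)) = t * (t * ?K - 2 * (?y \<bullet> ?y))"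
    using x inner_symmetric_matrix[OF sym, of x ?y]
    by (simp add: matrix_vector_mult_diff_distrib matrix_vector_mult_scaleR inner_diff_left
        inner_diff_right inner_commute algebra_simps)
  then have "0 \<le> t * (t * ?K - 2 * (?y \<bullet> ?y))"
    using psd by metis
  then have "2 * (?y \<bullet> ?y) \<le> t * ?K"
    using t by (simp add: zero_le_mult_iff)
  also have "\<dots> \<le> t * (?K + 1)"
    using t by simp
  also have "\<dots> = ?y \<bullet> ?y"
    using K by (simp add: t_def)
  finally show False
    using y by simp
qed

text \<open>Up to a vector killed by \<open>A\<close>, each \<open>x\<close> is the combination of
  the \<open>u i\<close> with coefficients \<open>v i \<bullet> x\<close>. Used in both arguments of
  the form, this expands \<open>A\<close> in products of the \<open>v i\<close>.\<close>

lemma rank_one_comb_of_kernel: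
  fixes v :: "'s::finite \<Rightarrow> real ^ 'm"
  assumes dual: "\<And>i j. u i \<bullet> v j = (if i = j then 1 else 0)"
    and sym: "A \<in> sym_matrices"
    and ker: "\<And>x. (\<And>i. v i \<bullet> x = 0) \<Longrightarrow> A *v x = 0"
  shows "A = rank_one_comb v (\<lambda>i j. u i \<bullet> (A *v u j))"
proof -
  have expand: "A *v x = (\<Sum>i\<in>UNIV. (v i \<bullet> x) *\<^sub>R (A *v u i))" for x
  proof -
    have "A *v (x - (\<Sum>i\<in>UNIV. (v i \<bullet> x) *\<^sub>R u i)) = 0"
    proof (rule ker)
      fix j
      have "v j \<bullet> (\<Sum>i\<in>UNIV. (v i \<bullet> x) *\<^sub>R u i) = (\<Sum>i\<in>UNIV. (v i \<bullet> x) * (u i \<bullet> v j))"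
        by (simp add: inner_sum_right inner_commute)
      also have "\<dots> = v j \<bullet> x"
        by (simp add: dual mult_delta_right)
      finally show "v j \<bullet> (x - (\<Sum>i\<in>UNIV. (v i \<bullet> x) *\<^sub>R u i)) = 0"
        by (simp add: inner_diff_right)
    qed
    then show ?thesis
      by (simp add: matrix_vector_mult_diff_distrib matrix_vector_mult_scaleR
          linear_sum[OF matrix_vector_mul_linear])
  qed
  have uAu: "u j \<bullet> (A *v u i) = u i \<bullet> (A *v u j)" for i j
    by (metis inner_symmetric_matrix[OF sym] inner_commute)
  have "A $ a $ b = rank_one_comb v (\<lambda>i j. u i \<bullet> (A *v u j)) $ a $ b" for a b
  proof -
    have "A $ a $ b = axis a 1 \<bullet> (A *v axis b 1)"
      by (simp add: inner_axis' matrix_vector_mult_basis column_def)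
    also have "\<dots> = (\<Sum>j\<in>UNIV. v j $ b * (axis a 1 \<bullet> (A *v u j)))"
      by (subst expand) (simp add: inner_sum_right inner_axis)
    also have "\<dots> = (\<Sum>j\<in>UNIV. v j $ b * (u j \<bullet> (A *v axis a 1)))"
      by (simp add: inner_symmetric_matrix[OF sym, of "axis a 1"] inner_commute)
    also have "\<dots> = (\<Sum>j\<in>UNIV. v j $ b * (\<Sum>i\<in>UNIV. v i $ a * (u j \<bullet> (A *v u i))))"
      by (subst expand) (simp add: inner_sum_right inner_axis)
    also have "\<dots> = (\<Sum>j\<in>UNIV. \<Sum>i\<in>UNIV. (u i \<bullet> (A *v u j)) * (v i $ a * v j $ b))"
      unfolding sum_distrib_left
      by (intro sum.cong refl) (simp add: uAu mult_ac)
    also have "\<dots> = (\<Sum>i\<in>UNIV. \<Sum>j\<in>UNIV. (u i \<bullet> (A *v u j)) * (v i $ a * v j $ b))"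
      by (rule sum.swap)
    finally show ?thesis
      by (simp add: rank_one_comb_def rank_one_def)
  qed
  then show ?thesis
    by (simp add: vec_eq_iff)
qed

lemma psd_matrices_sum:
  assumes "finite I" "\<And>i. i \<in> I \<Longrightarrow> 0 \<le> c i" "\<And>i. i \<in> I \<Longrightarrow> A i \<in> psd_matrices"
  shows "(\<Sum>i\<in>I. c i *\<^sub>R A i) \<in> psd_matrices"
  using assms
proof (induction I rule: finite_induct)
  case empty
  then show ?case
    by (simp add: psd_matrices_def sym_matrices_def transpose_def vec_eq_iff)
next
  case (insert i I)
  then have "A i \<in> psd_matrices" "(\<Sum>i\<in>I. c i *\<^sub>R A i) \<in> psd_matrices" "0 \<le> c i"
    by auto
  then have "c i *\<^sub>R A i + (\<Sum>i\<in>I. c i *\<^sub>R A i) \<in> psd_matrices"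
    by (auto simp: psd_matrices_def sym_matrices_def transpose_def vec_eq_iff
        matrix_vector_mult_add_rdistrib scaleR_matrix_vector_assoc[symmetric] inner_add_right)
  then show ?case
    using insert by simp
qed

text \<open>If a point of the ray cone lies between \<open>a\<close> and \<open>b\<close>,
  semidefiniteness makes \<open>a\<close> kill every vector orthogonal to all \<open>v i\<close>, so
  \<open>a\<close> is a combination of products of the \<open>v i\<close>. Being a moment matrix, it
  has no off-diagonal terms, and its diagonal coefficients are values of a nonnegative form.\<close>

lemma ray_cone_face_of_pseudo_moment_cone:
  fixes v :: "'s::finite \<Rightarrow> real ^ 'm::finite" and e :: "'m \<Rightarrow> 'k \<Rightarrow> nat"
  assumes dual: "\<And>i j. u i \<bullet> v j = (if i = j then 1 else 0)"
    and mom: "\<And>i. outer (v i) \<in> moment_matrices e"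
    and offdiag: "products_independent e v"
    and r: "\<And>i. 0 < r i"
  shows "ray_cone (\<lambda>i. r i *\<^sub>R outer (v i)) UNIV face_of pseudo_moment_cone e"
  unfolding face_of_def
proof (intro conjI ballI impI)
  let ?N = "\<lambda>i. r i *\<^sub>R outer (v i)"
  show "convex (ray_cone ?N UNIV)"
    by (rule convex_ray_cone)
  show "ray_cone ?N UNIV \<subseteq> pseudo_moment_cone e"
  proof
    fix Y
    assume "Y \<in> ray_cone ?N UNIV"
    then obtain c where c: "Y = (\<Sum>i\<in>UNIV. c i *\<^sub>R ?N i)" "\<And>i. 0 \<le> c i"
      unfolding ray_cone_def by auto
    have "Y \<in> moment_matrices e"
      unfolding c(1) by (intro subspace_sum subspace_scale subspace_moment_matrices mom)
    moreover have "(\<Sum>i\<in>UNIV. (c i * r i) *\<^sub>R outer (v i)) \<in> psd_matrices"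
      using c(2) r by (intro psd_matrices_sum outer_psd) (simp_all add: less_imp_le)
    ultimately show "Y \<in> pseudo_moment_cone e"
      by (simp add: pseudo_moment_cone_def c(1))
  qed
  \<comment> \<open>Stated for one endpoint with an explicit parameter, so that exchanging the
    endpoints and using \<open>1 - t\<close> yields the other.\<close>
  have key: "a \<in> ray_cone ?N UNIV"
    if a: "a \<in> pseudo_moment_cone e" and b: "b \<in> pseudo_moment_cone e"
      and x: "x \<in> ray_cone ?N UNIV" and t: "0 < t" "t < 1" "x = (1 - t) *\<^sub>R a + t *\<^sub>R b"
    for a b x t
  proof -
    have a': "a \<in> psd_matrices" "a \<in> sym_matrices" "a \<in> moment_matrices e"
      "\<And>y. 0 \<le> y \<bullet> (a *v y)" and b': "\<And>y. 0 \<le> y \<bullet> (b *v y)"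
      using a b by (auto simp: pseudo_moment_cone_def psd_matrices_def)
    obtain c where c: "x = (\<Sum>i\<in>UNIV. c i *\<^sub>R ?N i)"
      using x unfolding ray_cone_def by auto
    have "a *v y = 0" if y: "\<And>i. v i \<bullet> y = 0" for y
    proof (rule psd_quadratic_form_eq_0[OF a'(1)])
      have "y \<bullet> (x *v y) = x \<bullet> rank_one y y"
        by (simp add: inner_rank_one)
      also have "\<dots> = (\<Sum>i\<in>UNIV. c i * (r i * (rank_one y y \<bullet> rank_one (v i) (v i))))"
        unfolding c outer_eq_rank_one inner_sum_left inner_scaleR_left
        by (simp only: inner_commute[of "rank_one y y"])
      also have "\<dots> = 0"
      proof -
        have "rank_one y y *v v i = 0" for i
          using y[of i] by (simp add: vec_eq_iff rank_one_def matrix_vector_mult_def inner_vec_def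
              sum_distrib_left[symmetric] mult.assoc mult.commute[of "y $ _" "v i $ _"])
        then show ?thesis
          by (simp add: inner_rank_one)
      qed
      finally have "(1 - t) * (y \<bullet> (a *v y)) + t * (y \<bullet> (b *v y)) = 0"
        unfolding t(3)
        by (simp add: matrix_vector_mult_add_rdistrib scaleR_matrix_vector_assoc[symmetric]
            inner_add_right)
      moreover have "0 \<le> (1 - t) * (y \<bullet> (a *v y))" "0 \<le> t * (y \<bullet> (b *v y))"
        using t a'(4) b' by simp_all
      ultimately show "y \<bullet> (a *v y) = 0"
        using t by (simp add: add_nonneg_eq_0_iff)
    qed
    then have a_eq: "a = rank_one_comb v (\<lambda>i j. u i \<bullet> (a *v u j))"
      using rank_one_comb_of_kernel[OF dual a'(2)] by blast
    have off: "u i \<bullet> (a *v u j) = 0" if "i \<noteq> j" for i j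
    proof (rule products_independentD[OF offdiag, of "\<lambda>i j. u i \<bullet> (a *v u j)", OF _ _ that])
      show "u i \<bullet> (a *v u j) = u j \<bullet> (a *v u i)" for i j
        by (metis inner_symmetric_matrix[OF a'(2)] inner_commute)
      show "rank_one_comb v (\<lambda>i j. u i \<bullet> (a *v u j)) \<in> moment_matrices e"
        using a'(3) a_eq by metis
    qed
    have "a = (\<Sum>i\<in>UNIV. (u i \<bullet> (a *v u i)) *\<^sub>R outer (v i))"
    proof -
      have "rank_one_comb v (\<lambda>i j. u i \<bullet> (a *v u j)) =
          (\<Sum>i\<in>UNIV. \<Sum>j\<in>UNIV. if j = i then (u i \<bullet> (a *v u i)) *\<^sub>R outer (v i) else 0)"
        unfolding rank_one_comb_def outer_eq_rank_one
        by (intro sum.cong refl) (auto simp: off)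
      then show ?thesis
        using a_eq by simp
    qed
    also have "\<dots> = (\<Sum>i\<in>UNIV. ((u i \<bullet> (a *v u i)) / r i) *\<^sub>R ?N i)"
      using r by (intro sum.cong refl) (simp add: less_imp_neq[symmetric])
    finally have "a = (\<Sum>i\<in>UNIV. ((u i \<bullet> (a *v u i)) / r i) *\<^sub>R ?N i)" .
    moreover have "0 \<le> (u i \<bullet> (a *v u i)) / r i" for i
      using a'(4) r[of i] by simp
    ultimately show ?thesis
      unfolding ray_cone_def by (intro CollectI exI[of _ "\<lambda>i. (u i \<bullet> (a *v u i)) / r i"]) auto
  qed
  fix a b x
  assume a: "a \<in> pseudo_moment_cone e" and b: "b \<in> pseudo_moment_cone e"
    and x: "x \<in> ray_cone ?N UNIV" and "x \<in> open_segment a b"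
  then obtain t where t: "0 < t" "t < 1" "x = (1 - t) *\<^sub>R a + t *\<^sub>R b"
    unfolding in_segment by blast
  show "a \<in> ray_cone ?N UNIV"
    by (rule key[OF a b x t])
  show "b \<in> ray_cone ?N UNIV"
    by (rule key[OF b a x, of "1 - t"]) (use t in \<open>simp_all add: add.commute\<close>)
qed

section \<open>Dimension count and assembly of the result\<close>

lemma monomials_nonzero:
  assumes "bij_betw e UNIV (homog_exponents d)"
  shows "monomials e z \<noteq> 0"
proof -
  \<comment> \<open>The pure power of the homogenising coordinate, which gives the constant monomial
    1.\<close>
  have "(\<lambda>i. if i = None then d else 0) \<in> homog_exponents d"
    by (simp add: homog_exponents_def)
  then obtain a where a: "e a = (\<lambda>i. if i = None then d else 0)"
    using assms by (metis bij_betw_imp_surj_on imageE)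
  have "monomials e z $ a = 1"
    by (simp add: monomials_component a)
  then show ?thesis
    by (metis zero_index zero_neq_one)
qed

text \<open>Sums of two exponents have degree \<open>2 * d\<close>, which bounds the number of
  moment conditions. Multiplied by \<open>CARD('m)\<close>, the bound on \<open>s\<close> then keeps
  moment, kernel and symmetry conditions together below the number of matrix entries.\<close>

lemma moment_count:
  fixes e :: "'m::finite \<Rightarrow> 'n::finite option \<Rightarrow> nat"
  assumes e: "bij_betw e UNIV (homog_exponents d)" and "0 < s"
    and s: "real s \<le> 1 / 2 * (real ((CARD('n) + d) choose d) + 1)
      - inverse (real ((CARD('n) + d) choose d)) * real ((CARD('n) + 2 * d) choose (2 * d))"
  shows "card (range (\<lambda>(a, b) i. e a i + e b i)) + (s - 2) * CARD('m) + (CARD('m) choose 2)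
    < CARD('m) * CARD('m)"
proof -
  let ?N = "CARD('m)" and ?M = "(CARD('n) + 2 * d) choose (2 * d)"
  let ?G = "card (range (\<lambda>(a, b) i. e a i + e b i))"
  have N: "(CARD('n) + d) choose d = ?N"
    using bij_betw_same_card[OF e] card_homog_exponents[of d, where 'k = "'n option"] by simp
  have "e a \<in> homog_exponents d" for a
    using e by (auto simp: bij_betw_def)
  then have "range (\<lambda>(a, b) i. e a i + e b i) \<subseteq> homog_exponents (2 * d)"
    by (auto simp: homog_exponents_def sum.distrib)
  moreover have "card (homog_exponents (2 * d) :: ('n option \<Rightarrow> nat) set) = ?M"
    by (simp add: card_homog_exponents)
  moreover from this have "finite (homog_exponents (2 * d) :: ('n option \<Rightarrow> nat) set)"
    by (intro card_ge_0_finite) simp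
  ultimately have G: "?G \<le> ?M"
    using card_mono[of "homog_exponents (2 * d)" "range (\<lambda>(a, b) i. e a i + e b i)"] by simp
  have N0: "0 < real ?N"
    by simp
  have "real s * real ?N \<le>
      (1 / 2 * (real ?N + 1) - inverse (real ?N) * real ?M) * real ?N"
    using s N0 unfolding N by (intro mult_right_mono) simp_all
  also have "\<dots> = real ?N * (real ?N + 1) / 2 - real ?M"
    using N0 by (simp add: field_simps)
  finally have sN: "real s * real ?N \<le> real ?N * (real ?N + 1) / 2 - real ?M" .
  have choose2: "real (?N choose 2) = real ?N * (real ?N - 1) / 2"
    by (simp add: choose_two real_of_nat_div of_nat_diff)
  \<comment> \<open>Truncated subtraction gives \<open>s - 2 = 0\<close> at \<open>s = 1\<close>;
    the estimate by \<open>s - 1\<close> covers this case and still leaves a surplus of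
    \<open>CARD('m)\<close>.\<close>
  have "real (s - 2) \<le> real s - 1"
    using \<open>0 < s\<close> by simp
  then have "real (s - 2) * real ?N \<le> (real s - 1) * real ?N"
    using N0 by (intro mult_right_mono) simp_all
  also have "\<dots> = real s * real ?N - real ?N"
    by (simp add: algebra_simps)
  finally have "real ?G + real (s - 2) * real ?N + real (?N choose 2) \<le>
      real ?N * (real ?N + 1) / 2 - real ?N + real ?N * (real ?N - 1) / 2"
    using sN choose2 G by linarith
  also have "\<dots> = real ?N * real ?N - real ?N"
    by (simp add: field_simps)
  also have "\<dots> < real ?N * real ?N"
    using N0 by simp
  finally have "real (?G + (s - 2) * ?N + (?N choose 2)) < real (?N * ?N)"
    by simp
  then show ?thesis
    by (simp only: of_nat_less_iff)
qed

text \<open>For fixed points the face structure is deterministic. A run can fail only if some draw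
  gives two rays the same value, which is a countable union of null events.\<close>

lemma erd_almost_surely:
  fixes e :: "'m::finite \<Rightarrow> 'k \<Rightarrow> nat" and v :: "'s::finite \<Rightarrow> real ^ 'm" and h :: "'s \<Rightarrow> nat"
    and P :: "'w measure" and B :: "nat \<Rightarrow> 'w \<Rightarrow> real ^ 'm ^ 'm"
  assumes h: "inj h"
    and indep: "indexed_independent {(i, j). h i < h j}
      (\<lambda>p. hankel_defect e (sym_outer (v (fst p)) (v (snd p))))"
    and mom: "\<And>i. outer (v i) \<in> moment_matrices e"
    and nz: "\<And>i. v i \<noteq> 0" "\<And>i. w i \<noteq> 0"
    and B: "\<And>k. 1 \<le> k \<Longrightarrow> B k \<in> P \<rightarrow>\<^sub>M borel"
    and ac: "\<And>k. 1 \<le> k \<Longrightarrow> absolutely_continuous sym_lebesgue (distr P borel (B k))"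
  defines "C \<equiv> pseudo_moment_cone e" and "X \<equiv> \<Sum>i\<in>UNIV. (w i)\<^sup>2 *\<^sub>R outer (v i)"
  shows "AE \<omega> in P. erd_terminates C (\<lambda>k. B k \<omega>) X \<and>
    (\<forall>ts. erd_returns C (\<lambda>k. B k \<omega>) X ts \<longrightarrow> (\<exists>l. distinct l \<and> set l = UNIV \<and>
      ts = map (\<lambda>i. ((w i)\<^sup>2 * (norm (v i))\<^sup>2, (1 / (norm (v i))\<^sup>2) *\<^sub>R outer (v i))) l))"
proof -
  have offdiag: "products_independent e v"
    using h indep mom by (rule products_independentI)
  then have "a i = 0" if "(\<Sum>i\<in>UNIV. a i *\<^sub>R v i) = 0" for a i
    using nz(1) that by (rule products_independent_imp_independent)
  then obtain u where dual: "\<And>i j. u i \<bullet> v j = (if i = j then 1 else 0)"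
    using exists_dual_family[of v] by blast
  define r where "r i = 1 / (norm (v i))\<^sup>2" for i
  define c where "c i = (w i)\<^sup>2 * (norm (v i))\<^sup>2" for i
  define N where "N i = r i *\<^sub>R outer (v i)" for i
  have r: "0 < r i" and c: "0 < c i" for i
    using nz by (simp_all add: r_def c_def)
  interpret simplicial_face C N
  proof
    show "ray_cone N UNIV face_of C"
      unfolding C_def N_def
      using dual mom offdiag r by (rule ray_cone_face_of_pseudo_moment_cone)
    have "trace (N i) = r i * (v i \<bullet> v i)" for i
      by (simp add: N_def trace_def outer_def inner_vec_def sum_distrib_left)
    then show "trace (N i) = 1" for i
      using nz(1)[of i] by (simp add: r_def power2_norm_eq_inner)
    show "a i = 0" if a: "(\<Sum>i\<in>UNIV. a i *\<^sub>R N i) = 0" for a i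
    proof -
      \<comment> \<open>Pairing with the rank-one square of the dual vector \<open>u i\<close> picks
        out the coefficient of ray \<open>i\<close>.\<close>
      have "0 = rank_one (u i) (u i) \<bullet> (\<Sum>j\<in>UNIV. a j *\<^sub>R N j)"
        by (simp add: a)
      also have "\<dots> = (\<Sum>j\<in>UNIV. a j * r j * (rank_one (u i) (u i) \<bullet> rank_one (v j) (v j)))"
        by (simp add: inner_sum_right N_def outer_eq_rank_one mult.assoc)
      also have "\<dots> = (\<Sum>j\<in>UNIV. a j * r j * (if i = j then 1 else 0))"
      proof (intro sum.cong refl)
        fix j
        have "rank_one (u i) (u i) \<bullet> rank_one (v j) (v j) = (u i \<bullet> v j)\<^sup>2"
          by (simp add: inner_matrix rank_one_def inner_vec_def power2_eq_square sum_product mult_ac)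
        then show "a j * r j * (rank_one (u i) (u i) \<bullet> rank_one (v j) (v j)) =
            a j * r j * (if i = j then 1 else 0)"
          by (simp add: dual)
      qed
      also have "\<dots> = a i * r i"
        by (simp add: mult_delta_right)
      finally show ?thesis
        using r[of i] by simp
    qed
  qed
  have N: "N i \<in> sym_matrices" for i
    by (simp add: N_def sym_matrices_def transpose_def outer_def vec_eq_iff mult.commute)
  have "inj N"
  proof (rule injI)
    fix i j
    assume "N i = N j"
    then have "comb (\<lambda>k. if k = i then 1 else 0) = comb (\<lambda>k. if k = j then 1 else 0)"
      by (simp add: comb_single)
    then show "i = j"
      unfolding comb_eq_iff by (metis zero_neq_one)
  qed
  have "AE \<omega> in P. 1 \<le> k \<longrightarrow> inj (\<lambda>i. trace (B k \<omega> ** N i))" for k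
    using AE_inj_trace[OF B ac N \<open>inj N\<close>, of k] by (cases "1 \<le> k") auto
  then have AE: "AE \<omega> in P. \<forall>k. 1 \<le> k \<longrightarrow> inj (\<lambda>i. trace (B k \<omega> ** N i))"
    by (simp only: AE_all_countable) simp
  have X: "X = comb c"
    unfolding X_def comb_def N_def c_def r_def using nz(1) by (simp add: field_simps)
  from AE show ?thesis
  proof (rule AE_mp, intro AE_I2 impI conjI allI)
    fix \<omega>
    assume "\<forall>k. 1 \<le> k \<longrightarrow> inj (\<lambda>i. trace (B k \<omega> ** N i))"
    then have inj: "inj (\<lambda>i. trace (B k \<omega> ** N i))" if "1 \<le> k" for k
      using that by blast
    show "erd_terminates C (\<lambda>k. B k \<omega>) X"
      unfolding X using c inj by (rule erd_terminates_comb)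
    fix ts
    assume "erd_returns C (\<lambda>k. B k \<omega>) X ts"
    then have "erd_returns C (\<lambda>k. B k \<omega>) (comb c) ts"
      unfolding X .
    with c inj obtain l where "distinct l" "set l = UNIV" "ts = map (\<lambda>i. (c i, N i)) l"
      by (rule erd_returns_comb)
    then show "\<exists>l. distinct l \<and> set l = UNIV \<and>
        ts = map (\<lambda>i. ((w i)\<^sup>2 * (norm (v i))\<^sup>2, (1 / (norm (v i))\<^sup>2) *\<^sub>R outer (v i))) l"
      unfolding c_def N_def r_def by blast
  qed
qed

theorem theorem4:
  fixes d :: nat
    and e :: "'m::finite \<Rightarrow> 'n::finite option \<Rightarrow> nat"
  assumes "d \<ge> 2"
    and "bij_betw e UNIV (homog_exponents d)"
    and "real CARD('s::finite) \<le>
           1 / 2 * (real ((CARD('n) + d) choose d) + 1)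
           - inverse (real ((CARD('n) + d) choose d)) * real ((CARD('n) + 2 * d) choose (2 * d))"
  shows "generically (\<lambda>wz :: (real \<times> (real ^ 'n)) ^ 's.
    let w = (\<lambda>i. fst (wz $ i));
        z = (\<lambda>i. snd (wz $ i));
        X = (\<Sum>i\<in>UNIV. (w i)\<^sup>2 *\<^sub>R outer (monomials e (z i)));
        C = pseudo_moment_cone e
    in \<forall>(P :: 'w measure) (B :: nat \<Rightarrow> 'w \<Rightarrow> real ^ 'm ^ 'm).
         prob_space P \<longrightarrow>
         prob_space.indep_vars P (\<lambda>_. borel) B {1..} \<longrightarrow>
         (\<forall>k\<ge>1. absolutely_continuous sym_lebesgue (distr P borel (B k))) \<longrightarrow>
         (AE \<omega> in P.
            erd_terminates C (\<lambda>k. B k \<omega>) X \<and>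
            (\<forall>ts. erd_returns C (\<lambda>k. B k \<omega>) X ts \<longrightarrow>
               length ts = CARD('s) \<and>
               (\<exists>\<pi>. bij_betw \<pi> {1..CARD('s)} UNIV \<and>
                  (\<forall>k\<in>{1..CARD('s)}. ts ! (k - 1) =
                     ((w (\<pi> k))\<^sup>2 * (norm (monomials e (z (\<pi> k))))\<^sup>2,
                      (1 / (norm (monomials e (z (\<pi> k))))\<^sup>2) *\<^sub>R outer (monomials e (z (\<pi> k)))))))))"
proof -
  \<comment> \<open>An arbitrary numbering of the points, to select one of \<open>(i, j)\<close> and
    \<open>(j, i)\<close>.\<close>
  obtain h :: "'s \<Rightarrow> nat" where h: "inj h"
    using finite_imp_inj_to_nat_seg[of "UNIV :: 's set"] by auto
  let ?S = "{(i, j). h i < h j}"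
  have count: "card (range (\<lambda>(a, b) i. e a i + e b i)) + (CARD('s) - 2) * CARD('m) +
      (CARD('m) choose 2) < CARD('m) * CARD('m)"
    by (rule moment_count[OF assms(2) _ assms(3)]) simp
  \<comment> \<open>\<open>G\<close> is nonzero exactly when the symmetrised products are
    independent modulo moment matrices, \<open>W\<close> exactly when all weights are nonzero; the
    generic set is where \<open>G wz * W wz\<close> does not vanish.\<close>
  define G where "G wz = det (gram_matrix ?S (pair_defect e wz))"
    for wz :: "(real \<times> (real ^ 'n)) ^ 's"
  define W where "W wz = (\<Prod>i\<in>UNIV. fst (wz $ i))" for wz :: "(real \<times> (real ^ 'n)) ^ 's"
  have G: "real_polynomial_function G"
    unfolding G_def by (rule real_polynomial_function_det_pair_defect)
  have W: "real_polynomial_function W"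
    unfolding W_def by (intro real_polynomial_function_prod real_polynomial_function.intros(1)
        bounded_linear_compose[OF bounded_linear_fst] bounded_linear_vec_nth finite)
  obtain wz0 where G0: "G wz0 \<noteq> 0"
    using exists_independent_pair_defects[OF assms(2) count subset_refl]
    by (auto simp: G_def det_gram_matrix_nonzero_iff)
  have W1: "W (\<chi> i. (1, 0)) \<noteq> 0"
    by (simp add: W_def)
  \<comment> \<open>\<open>G\<close> and \<open>W\<close> are each nonzero somewhere; a common point
    on the line shows that their product is not identically zero.\<close>
  obtain t where t: "G (wz0 + t *\<^sub>R ((\<chi> i. (1, 0)) - wz0)) \<noteq> 0"
      "W (wz0 + t *\<^sub>R ((\<chi> i. (1, 0)) - wz0)) \<noteq> 0"
    using real_polynomial_functions_nonzero_on_line[OF G W G0 W1] .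
  show ?thesis
  proof (rule genericallyI)
    show "real_polynomial_function (\<lambda>wz. G wz * W wz)"
      by (rule real_polynomial_function.intros(4)[OF G W])
    show "G (wz0 + t *\<^sub>R ((\<chi> i. (1, 0)) - wz0)) * W (wz0 + t *\<^sub>R ((\<chi> i. (1, 0)) - wz0)) \<noteq> 0"
      using t by simp
    fix wz :: "(real \<times> (real ^ 'n)) ^ 's"
    assume "G wz * W wz \<noteq> 0"
    then have indep: "indexed_independent ?S (pair_defect e wz)" and w: "\<And>i. fst (wz $ i) \<noteq> 0"
      by (simp_all add: G_def W_def det_gram_matrix_nonzero_iff)
    let ?w = "\<lambda>i. fst (wz $ i)" and ?v = "\<lambda>i. monomials e (snd (wz $ i))"
    \<comment> \<open>A duplicate-free list of all indices is a permutation; list positions start at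
      0 and the claim at 1, hence the shift \<open>k - 1\<close>.\<close>
    have reorder: "length ts = CARD('s) \<and> (\<exists>\<pi>. bij_betw \<pi> {1..CARD('s)} UNIV \<and>
        (\<forall>k\<in>{1..CARD('s)}. ts ! (k - 1) = f (\<pi> k)))"
      if l: "distinct l" "set l = (UNIV :: 's set)" and ts: "ts = map f l"
      for ts l and f :: "'s \<Rightarrow> real \<times> (real ^ 'm ^ 'm)"
    proof -
      have len: "length l = CARD('s)"
        using distinct_card[OF l(1)] l(2) by simp
      have "bij_betw (\<lambda>k. k - 1) {1..CARD('s)} {..<CARD('s)}"
        by (rule bij_betw_byWitness[where f' = Suc]) auto
      then have "bij_betw ((!) l \<circ> (\<lambda>k. k - 1)) {1..CARD('s)} UNIV"
        using bij_betw_nth[OF l(1) refl refl] l(2) len by (metis bij_betw_trans)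
      then show ?thesis
        using ts len by (intro conjI exI[of _ "(!) l \<circ> (\<lambda>k. k - 1)"]) auto
    qed
    show "let w = ?w; z = (\<lambda>i. snd (wz $ i));
        X = (\<Sum>i\<in>UNIV. (w i)\<^sup>2 *\<^sub>R outer (monomials e (z i)));
        C = pseudo_moment_cone e
      in \<forall>(P :: 'w measure) (B :: nat \<Rightarrow> 'w \<Rightarrow> real ^ 'm ^ 'm).
         prob_space P \<longrightarrow>
         prob_space.indep_vars P (\<lambda>_. borel) B {1..} \<longrightarrow>
         (\<forall>k\<ge>1. absolutely_continuous sym_lebesgue (distr P borel (B k))) \<longrightarrow>
         (AE \<omega> in P.
            erd_terminates C (\<lambda>k. B k \<omega>) X \<and>
            (\<forall>ts. erd_returns C (\<lambda>k. B k \<omega>) X ts \<longrightarrow>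
               length ts = CARD('s) \<and>
               (\<exists>\<pi>. bij_betw \<pi> {1..CARD('s)} UNIV \<and>
                  (\<forall>k\<in>{1..CARD('s)}. ts ! (k - 1) =
                     ((w (\<pi> k))\<^sup>2 * (norm (monomials e (z (\<pi> k))))\<^sup>2,
                      (1 / (norm (monomials e (z (\<pi> k))))\<^sup>2) *\<^sub>R outer (monomials e (z (\<pi> k))))))))"
      unfolding Let_def
    proof (intro allI impI)
      fix P :: "'w measure" and B :: "nat \<Rightarrow> 'w \<Rightarrow> real ^ 'm ^ 'm"
      assume P: "prob_space P" and ind: "prob_space.indep_vars P (\<lambda>_. borel) B {1..}"
        and ac: "\<forall>k\<ge>1. absolutely_continuous sym_lebesgue (distr P borel (B k))"
      have "B k \<in> P \<rightarrow>\<^sub>M borel" if "1 \<le> k" for k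
        using ind that unfolding prob_space.indep_vars_def[OF P] by auto
      moreover have "outer (?v i) \<in> moment_matrices e" for i
        unfolding monomials_def by (rule outer_homog_monomials_moment)
      ultimately have "AE \<omega> in P.
          erd_terminates (pseudo_moment_cone e) (\<lambda>k. B k \<omega>)
            (\<Sum>i\<in>UNIV. (?w i)\<^sup>2 *\<^sub>R outer (?v i)) \<and>
          (\<forall>ts. erd_returns (pseudo_moment_cone e) (\<lambda>k. B k \<omega>)
              (\<Sum>i\<in>UNIV. (?w i)\<^sup>2 *\<^sub>R outer (?v i)) ts \<longrightarrow>
            (\<exists>l. distinct l \<and> set l = UNIV \<and> ts = map (\<lambda>i. ((?w i)\<^sup>2 * (norm (?v i))\<^sup>2,
              (1 / (norm (?v i))\<^sup>2) *\<^sub>R outer (?v i))) l))"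
        using monomials_nonzero[OF assms(2)] w ac indep
        by (intro erd_almost_surely[OF h]) (simp_all add: pair_defect_def[abs_def])
      then show "AE \<omega> in P.
          erd_terminates (pseudo_moment_cone e) (\<lambda>k. B k \<omega>)
            (\<Sum>i\<in>UNIV. (?w i)\<^sup>2 *\<^sub>R outer (?v i)) \<and>
          (\<forall>ts. erd_returns (pseudo_moment_cone e) (\<lambda>k. B k \<omega>)
              (\<Sum>i\<in>UNIV. (?w i)\<^sup>2 *\<^sub>R outer (?v i)) ts \<longrightarrow>
            length ts = CARD('s) \<and>
            (\<exists>\<pi>. bij_betw \<pi> {1..CARD('s)} UNIV \<and>
              (\<forall>k\<in>{1..CARD('s)}. ts ! (k - 1) = ((?w (\<pi> k))\<^sup>2 * (norm (?v (\<pi> k)))\<^sup>2,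
                (1 / (norm (?v (\<pi> k)))\<^sup>2) *\<^sub>R outer (?v (\<pi> k))))))"
      proof (rule AE_mp, intro AE_I2 impI conjI allI; elim conjE)
        fix \<omega> ts
        let ?f = "\<lambda>i. ((?w i)\<^sup>2 * (norm (?v i))\<^sup>2, (1 / (norm (?v i))\<^sup>2) *\<^sub>R outer (?v i))"
        assume ret: "erd_returns (pseudo_moment_cone e) (\<lambda>k. B k \<omega>)
              (\<Sum>i\<in>UNIV. (?w i)\<^sup>2 *\<^sub>R outer (?v i)) ts"
          and "\<forall>ts. erd_returns (pseudo_moment_cone e) (\<lambda>k. B k \<omega>)
              (\<Sum>i\<in>UNIV. (?w i)\<^sup>2 *\<^sub>R outer (?v i)) ts \<longrightarrow>
            (\<exists>l. distinct l \<and> set l = UNIV \<and> ts = map ?f l)"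
        then obtain l where l: "distinct l" "set l = UNIV" "ts = map ?f l"
          by blast
        show "length ts = CARD('s)"
          using reorder[OF l] by blast
        show "\<exists>\<pi>. bij_betw \<pi> {1..CARD('s)} UNIV \<and>
            (\<forall>k\<in>{1..CARD('s)}. ts ! (k - 1) = ?f (\<pi> k))"
          using reorder[OF l] by blast
      qed assumption
    qed
  qed
qed

end
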